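(* Let $d\ge 1$, $w_1,\dots,w_d\in\mathcal H$, and $\bm w=(w_1,\dots,w_d)$. Then the derivative at $\alpha=0$ of the homogeneous Barnes zeta function is $$\begin{aligned} \zeta_{\rm Bh}'(0|\bm w)={}&\sum_{\bm n\in\mathbb N_0^d\setminus\{\bm 0\}}\Biggl[-\log(\bm n\cdot\bm w)-H_d+\sum_{m=0}^{d}\frac{{}_dS_m^{(d)}(0)}{m!\,(d-m)!}\,G\bigl[(\bm n\cdot\bm w+x)^{d-m}\log(\bm n\cdot\bm w+x)\bigr]_{x=\bm w}\Biggr]\\ &+\sum_{m=0}^{d}\frac{{}_dS_m^{(d)}(0)}{m!\,(d-m)!}F\bigl[x^{d-m}\log x\bigr]_{x=\bm w}-H_d. \end{aligned}$$
   Context: $\mathcal H=\{z\in\mathbb C:\theta-\frac{\pi}{2}<\arg z<\theta+\frac{\pi}{2}\}$ is a fixed open half-plane ($\theta$ a fixed real angle), and $\log$ is a fixed holomorphic branch of the logarithm on $\mathcal H$; $z^s=\exp(s\log z)$ for $z\in\mathcal H$. $\mathbb N_0=\{0,1,2,\dots\}$ and $\bm n\cdot\bm w=\sum_{i=1}^d n_iw_i$. The homogeneous Barnes zeta function is $\zeta_{\rm Bh}(\alpha|\bm w)=\sum_{\bm n\in\mathbb N_0^d\setminus\{\bm 0\}}(\bm n\cdot\bm w)^{-\alpha}$ for $\Re(\alpha)>d$; it extends meromorphically in $\alpha$ to $\mathbb C$, with at most simple poles, located at $\alpha=1,\dots,d$. The prime in $\zeta_{\rm Bh}'$ denotes the derivative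 with respect to $\alpha$. For $\bm v\in\mathbb C^d$ and a function $g$ of $x$, $F[g(x)]_{x=\bm v}=\sum_{\emptyset\ne S\subseteq\{1,\dots,d\}}(-1)^{d-|S|}g\bigl(\sum_{i\in S}v_i\bigr)$ and $G[g(x)]_{x=\bm v}=(-1)^dg(0)+F[g(x)]_{x=\bm v}$. Harmonic numbers: $H_k=\sum_{i=1}^k 1/i$, $H_0=0$. The higher order Bernoulli polynomials $B_n(a|\bm w)$ are defined by $z^d{\rm e}^{az}\prod_{i=1}^d\frac{w_i}{{\rm e}^{w_iz}-1}=\sum_{n\ge0}B_n(a|\bm w)\frac{z^n}{n!}$ for $|z|<2\pi/\max_i|w_i|$. The Bernoullian functions ${}_dS_n(a)$ ($n\ge0$; dependence on $\bm w$ suppressed) are the polynomials in $a$ with ${}_dS_n(0)=0$ and ${}_dS_n'(a)=\frac{n!}{(n+d-1)!\,\prod_{i=1}^dw_i}B_{n+d-1}(a|\bm w)$; ${}_dS_m^{(d)}(0)$ is the $d$-th derivative in $a$ at $a=0$ (equivalently ${}_dS_m^{(d)}(0)=B_m(0|\bm w)/\prod_{i=1}^dw_i$). The sum over $\mathbb N_0^d\setminus\{\bm 0\}$ is understood as an unordered (absolutely convergent) sum of the bracketed terms. *)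

theory Defs
  imports "HOL-Complex_Analysis.Complex_Analysis"
begin

text \<open>
  Vectors in \<open>\<complex>\<^sup>d\<close> are functions \<open>nat \<Rightarrow> complex\<close> of which only the values on \<open>{1..d}\<close> matter.
\<close>

text \<open>
  The condition on the argument is that some value of \<open>arg z\<close> lies in the given interval, so
  \<open>\<theta>\<close> need not be compatible with the principal range of \<^const>\<open>Arg\<close>.
\<close>
definition half_plane :: "real \<Rightarrow> complex set" where
  "half_plane \<theta> = {rcis r t |r t. r > 0 \<and> \<theta> - pi / 2 < t \<and> t < \<theta> + pi / 2}"

definition log_branch :: "real \<Rightarrow> (complex \<Rightarrow> complex) \<Rightarrow> bool" where
  "log_branch \<theta> lg \<longleftrightarrow>
     lg holomorphic_on half_plane \<theta> \<and> (\<forall>z\<in>half_plane \<theta>. exp (lg z) = z)"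

definition nonzero_indices :: "nat \<Rightarrow> (nat \<Rightarrow> nat) set" where
  "nonzero_indices d = ({1..d} \<rightarrow>\<^sub>E UNIV) - {\<lambda>i\<in>{1..d}. 0}"

definition lincomb :: "nat \<Rightarrow> (nat \<Rightarrow> nat) \<Rightarrow> (nat \<Rightarrow> complex) \<Rightarrow> complex" where
  "lincomb d n w = (\<Sum>i=1..d. of_nat (n i) * w i)"

text \<open>
  The meromorphic continuation of the series. It is unique because
  \<^const>\<open>nicely_meromorphic_on\<close> also fixes the value 0 at poles.
\<close>
definition barnes_zeta :: "(complex \<Rightarrow> complex) \<Rightarrow> nat \<Rightarrow> (nat \<Rightarrow> complex) \<Rightarrow> complex \<Rightarrow> complex" where
  "barnes_zeta lg d w =
     (THE Z. Z nicely_meromorphic_on UNIV \<and>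
        (\<forall>\<alpha>. Re \<alpha> > real d \<longrightarrow>
           Z \<alpha> = (\<Sum>\<^sub>\<infinity>n\<in>nonzero_indices d. exp (- \<alpha> * lg (lincomb d n w)))))"

definition F_op :: "nat \<Rightarrow> (complex \<Rightarrow> complex) \<Rightarrow> (nat \<Rightarrow> complex) \<Rightarrow> complex" where
  "F_op d g v = (\<Sum>S\<in>Pow {1..d} - {{}}. (-1) ^ (d - card S) * g (\<Sum>i\<in>S. v i))"

definition G_op :: "nat \<Rightarrow> (complex \<Rightarrow> complex) \<Rightarrow> (nat \<Rightarrow> complex) \<Rightarrow> complex" where
  "G_op d g v = (-1) ^ d * g 0 + F_op d g v"

text \<open>
  The generating function is required on the punctured disc only: at \<open>z = 0\<close> it has a removable
  singularity, where the division by zero would give the wrong value. The punctured disc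
  determines the coefficients.
\<close>
definition bernoulli_barnes :: "nat \<Rightarrow> (nat \<Rightarrow> complex) \<Rightarrow> nat \<Rightarrow> complex \<Rightarrow> complex" where
  "bernoulli_barnes d w n a =
     (THE b. \<forall>z. z \<noteq> 0 \<and> norm z < 2 * pi / (MAX i\<in>{1..d}. norm (w i)) \<longrightarrow>
        (\<lambda>k. b k * z ^ k / fact k) sums
          (z ^ d * exp (a * z) * (\<Prod>i=1..d. w i / (exp (w i * z) - 1)))) n"

text \<open>The Bernoullian function \<open>\<^sub>dS\<^sub>n\<close> as a polynomial.\<close>
definition bernoullian :: "nat \<Rightarrow> (nat \<Rightarrow> complex) \<Rightarrow> nat \<Rightarrow> complex poly" where
  "bernoullian d w n =
     (THE p. poly p 0 = 0 \<and>
        (\<forall>a. poly (pderiv p) a =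
           fact n / (fact (n + d - 1) * (\<Prod>i=1..d. w i)) * bernoulli_barnes d w (n + d - 1) a))"

end

theory Submission
  imports Defs
begin

text \<open>
  Formally, \<open>\<Prod>\<^sub>i (exp (w\<^sub>i D) - 1)\<close> has the inverse \<open>\<Sum>\<^sub>m b\<^sub>m D\<^bsup>m-d\<^esup>\<close>, where
  \<open>\<Sum>\<^sub>m b\<^sub>m z\<^sup>m = \<Prod>\<^sub>i z / (exp (w\<^sub>i z) - 1)\<close>; the coefficient of \<open>G\<close> and \<open>F\<close> in the formula is
  \<open>b\<^sub>m / (d - m)!\<close>. Truncating the inverse at \<open>m = N\<close> and applying it to \<open>z\<^bsup>-\<alpha>\<^esup>\<close> gives a function \<open>\<psi>\<close>
  whose difference \<open>G[\<psi>(y + x)]\<close> equals \<open>y\<^bsup>-\<alpha>\<^esup>\<close> up to an error of order \<open>y\<^bsup>-\<alpha>-N-1\<^esup>\<close>. Summed over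
  \<open>y = n \<cdot> w\<close> with \<open>n \<noteq> 0\<close>, the differences telescope to \<open>-F[\<psi>]\<close> for large \<open>Re \<alpha>\<close>, and the errors are
  summable for \<open>Re \<alpha> > d - N - 1\<close>. This continues the zeta function to that half-plane; for \<open>N = d\<close>
  it contains \<open>\<alpha> = 0\<close>, where the continued series is differentiated term by term.
\<close>

section \<open>Preliminaries on half-planes and sums over indices\<close>

text \<open>Rotation by \<open>-\<theta>\<close> carries the half-plane to the right half-plane,
  where the condition on the argument becomes a sign condition. Openness, convexity and stability
  under addition then follow from linearity.\<close>

lemma half_plane_iff: "z \<in> half_plane \<theta> \<longleftrightarrow> Re (cis (-\<theta>) * z) > 0"
proof
  assume "z \<in> half_plane \<theta>"
  then obtain r t where rt: "z = rcis r t" "r > 0" "\<theta> - pi/2 < t" "t < \<theta> + pi/2"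
    by (auto simp: half_plane_def)
  have "cis (-\<theta>) * z = rcis r (t - \<theta>)"
    by (simp add: rt cis_rcis_eq rcis_mult)
  moreover have "cos (t - \<theta>) > 0"
    by (rule cos_gt_zero_pi) (use rt in auto)
  ultimately show "Re (cis (-\<theta>) * z) > 0"
    using rt by simp
next
  assume *: "Re (cis (-\<theta>) * z) > 0"
  define u where "u = cis (-\<theta>) * z"
  have u: "Re u > 0" "u \<noteq> 0"
    using * by (auto simp: u_def)
  have "\<bar>Im (Ln u)\<bar> < pi / 2"
    using Re_Ln_pos_lt_imp u by blast
  hence A: "\<bar>Arg u\<bar> < pi / 2"
    using u by (simp add: Arg_eq_Im_Ln)
  have "z = cis \<theta> * u"
    by (simp add: u_def cis_mult flip: mult.assoc)
  also have "\<dots> = rcis (norm u) (\<theta> + Arg u)"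
    by (subst (1) rcis_cmod_Arg[symmetric]) (simp add: cis_rcis_eq rcis_mult)
  finally show "z \<in> half_plane \<theta>"
    unfolding half_plane_def using A u by (intro CollectI exI[of _ "norm u"] exI[of _ "\<theta> + Arg u"]) auto
qed

lemma open_half_plane: "open (half_plane \<theta>)"
proof -
  have "half_plane \<theta> = (\<lambda>z. Re (cis (-\<theta>) * z)) -` {0<..}"
    by (auto simp: half_plane_iff)
  thus ?thesis
    by (auto intro!: open_vimage continuous_intros)
qed

lemma convex_half_plane: "convex (half_plane \<theta>)"
  unfolding convex_def
proof (intro ballI allI impI)
  fix x y :: complex and u v :: real
  assume *: "x \<in> half_plane \<theta>" "y \<in> half_plane \<theta>" "0 \<le> u" "0 \<le> v" "u + v = 1"
  show "u *\<^sub>R x + v *\<^sub>R y \<in> half_plane \<theta>"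
  proof -
    have "Re (cis (-\<theta>) * (u *\<^sub>R x + v *\<^sub>R y)) = u * Re (cis (-\<theta>) * x) + v * Re (cis (-\<theta>) * y)"
      by (simp add: algebra_simps)
    also have "\<dots> > 0"
    proof (cases "u = 0")
      case False
      thus ?thesis
        using * unfolding half_plane_iff by (intro add_pos_nonneg mult_nonneg_nonneg mult_pos_pos) auto
    qed (use * in \<open>simp add: half_plane_iff\<close>)
    finally show ?thesis by (simp only: half_plane_iff)
  qed
qed

section \<open>Unordered sums over the index lattice\<close>

lemma nonzero_indices_sum_ge_1:
  assumes "n \<in> nonzero_indices d"
  shows "(\<Sum>i=1..d. n i) \<ge> 1"
proof -
  have "(\<Sum>i=1..d. n i) \<noteq> 0"
  proof
    assume "(\<Sum>i=1..d. n i) = 0"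
    hence "n = (\<lambda>i\<in>{1..d}. 0)"
      using assms by (intro ext) (auto simp: nonzero_indices_def restrict_def dest: PiE_arb)
    thus False using assms by (simp add: nonzero_indices_def)
  qed
  thus ?thesis by linarith
qed

text \<open>Comparison with a product of \<open>d\<close> one-dimensional series of exponent
  \<open>s = \<sigma> / d > 1\<close>. With \<open>N\<close> the sum of the entries,
  \<open>N \<ge> 1\<close> gives \<open>n i + 1 \<le> 2 * N\<close>, so
  \<open>(2 * N) powr (-\<sigma>)\<close> is at most the product of the
  \<open>(n i + 1) powr (-s)\<close>.\<close>

lemma summable_on_powr_nonzero_indices:
  assumes "d \<ge> 1" "\<sigma> > real d"
  shows "(\<lambda>n. real (\<Sum>i=1..d. n i) powr (-\<sigma>)) summable_on nonzero_indices d"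
proof -
  define s where "s = \<sigma> / real d"
  have s: "s > 1" using assms by (simp add: s_def)
  have "summable (\<lambda>k. real (Suc k) powr (-s))"
    using s by (subst summable_Suc_iff) (simp add: summable_real_powr_iff)
  hence "Infinite_Set_Sum.abs_summable_on (\<lambda>k. real (Suc k) powr (-s)) UNIV"
    by (simp add: abs_summable_on_nat_iff')
  hence "Infinite_Set_Sum.abs_summable_on (\<lambda>n. \<Prod>i\<in>{1..d}. real (Suc (n i)) powr (-s)) ({1..d} \<rightarrow>\<^sub>E UNIV)"
    by (intro abs_summable_on_prod_PiE) auto
  hence "(\<lambda>n. \<Prod>i\<in>{1..d}. real (Suc (n i)) powr (-s)) summable_on ({1..d} \<rightarrow>\<^sub>E UNIV)"
    unfolding abs_summable_equivalent[symmetric] by (rule abs_summable_summable)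
  hence "(\<lambda>n. \<Prod>i\<in>{1..d}. real (Suc (n i)) powr (-s)) summable_on nonzero_indices d"
    by (rule summable_on_subset_banach) (auto simp: nonzero_indices_def)
  hence "(\<lambda>n. 2 powr \<sigma> * (\<Prod>i\<in>{1..d}. real (Suc (n i)) powr (-s))) summable_on nonzero_indices d"
    by (rule summable_on_cmult_right)
  thus ?thesis
  proof (rule summable_on_comparison_test)
    fix n assume n: "n \<in> nonzero_indices d"
    let ?N = "\<Sum>i=1..d. n i"
    have N: "?N \<ge> 1" using n by (rule nonzero_indices_sum_ge_1)
    have "(\<Prod>i\<in>{1..d}. (2 * real ?N) powr (-s)) \<le> (\<Prod>i\<in>{1..d}. real (Suc (n i)) powr (-s))"
    proof (rule prod_mono, safe)
      fix i assume i: "i \<in> {1..d}"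
      have "n i \<le> ?N" by (rule member_le_sum) (use i in auto)
      hence "Suc (n i) \<le> 2 * ?N" using N by linarith
      hence "real (Suc (n i)) \<le> 2 * real ?N" by linarith
      thus "(2 * real ?N) powr (-s) \<le> real (Suc (n i)) powr (-s)"
        using s by (intro powr_mono2') auto
    qed auto
    also have "(\<Prod>i\<in>{1..d}. (2 * real ?N) powr (-s)) = (2 * real ?N) powr (-\<sigma>)"
    proof -
      have "(c powr (-s)) ^ d = c powr (-\<sigma>)" if "c > 0" for c :: real
        using that assms powr_power[of c "-s" d] by (simp add: s_def)
      moreover have "2 * real ?N > 0" using N by linarith
      ultimately show ?thesis by (simp only: prod_constant card_atLeastAtMost) simp
    qed
    also have "\<dots> = 2 powr (-\<sigma>) * real ?N powr (-\<sigma>)"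
      by (simp add: powr_mult)
    finally have "2 powr \<sigma> * (2 powr (-\<sigma>) * real ?N powr (-\<sigma>)) \<le> 2 powr \<sigma> * (\<Prod>i\<in>{1..d}. real (Suc (n i)) powr (-s))"
      by (intro mult_left_mono) auto
    thus "real ?N powr (-\<sigma>) \<le> 2 powr \<sigma> * (\<Prod>i\<in>{1..d}. real (Suc (n i)) powr (-s))"
      by (simp add: powr_minus field_simps)
  qed auto
qed

text \<open>The Weierstrass M-test along the filter of finite subsets. Cauchy's inequality on the
  closed disc turns the majorant \<open>M\<close> of the terms into the majorant
  \<open>M / r\<close> of their derivatives at the centre.\<close>

lemma infsum_holomorphic_deriv:
  fixes f :: "'a \<Rightarrow> complex \<Rightarrow> complex"
  assumes r: "0 < r" "r < R"
    and hol: "\<And>n. n \<in> A \<Longrightarrow> f n holomorphic_on ball a R"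
    and bound: "\<And>n z. n \<in> A \<Longrightarrow> z \<in> cball a r \<Longrightarrow> norm (f n z) \<le> M n"
    and M: "M summable_on A"
  shows "(\<lambda>z. \<Sum>\<^sub>\<infinity>n\<in>A. f n z) holomorphic_on ball a r"
    and "(\<lambda>n. norm (deriv (f n) a)) summable_on A"
    and "((\<lambda>z. \<Sum>\<^sub>\<infinity>n\<in>A. f n z) has_field_derivative (\<Sum>\<^sub>\<infinity>n\<in>A. deriv (f n) a)) (at a)"
proof -
  let ?F = "finite_subsets_at_top A"
  have ulim: "uniform_limit (cball a r) (\<lambda>X z. \<Sum>n\<in>X. f n z) (\<lambda>z. \<Sum>\<^sub>\<infinity>n\<in>A. f n z) ?F"
    by (rule Weierstrass_m_test_general[OF bound M])
  have holc: "continuous_on (cball a r) (f n)" "f n holomorphic_on ball a r" if "n \<in> A" for n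
    by (auto intro!: holomorphic_on_imp_continuous_on holomorphic_on_subset[OF hol[OF that]] simp: r)
       (use r in auto)
  show dsum: "(\<lambda>n. norm (deriv (f n) a)) summable_on A"
  proof (rule summable_on_comparison_test)
    show "(\<lambda>n. M n * (1 / r)) summable_on A"
      by (intro summable_on_cmult_left M)
    fix n assume n: "n \<in> A"
    have "norm ((deriv ^^ 1) (f n) a) \<le> fact 1 * M n / r ^ 1"
      by (rule Cauchy_inequality) (use r holc[OF n] bound[OF n] in \<open>auto simp: dist_norm\<close>)
    thus "norm (deriv (f n) a) \<le> M n * (1 / r)" by simp
  qed auto
  have ev: "eventually (\<lambda>X. continuous_on (cball a r) (\<lambda>z. \<Sum>n\<in>X. f n z) \<and>
      (\<forall>z\<in>ball a r. ((\<lambda>z. \<Sum>n\<in>X. f n z) has_field_derivative (\<Sum>n\<in>X. deriv (f n) z)) (at z))) ?F"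
  proof (rule eventually_finite_subsets_at_top_weakI, safe)
    fix X assume X: "X \<subseteq> A" "finite X"
    show "continuous_on (cball a r) (\<lambda>z. \<Sum>n\<in>X. f n z)"
      using X holc by (intro continuous_intros) auto
    fix z assume z: "z \<in> ball a r"
    show "((\<lambda>z. \<Sum>n\<in>X. f n z) has_field_derivative (\<Sum>n\<in>X. deriv (f n) z)) (at z)"
    proof (rule DERIV_sum)
      fix n assume "n \<in> X"
      thus "(f n has_field_derivative deriv (f n) z) (at z)"
        using X holc z by (intro holomorphic_derivI[of _ "ball a r"]) auto
    qed
  qed
  \<comment> \<open>The theorem yields one value that is both the derivative of the limit and the
    limit of the finite sums of derivatives; at the centre this is the unordered sum of
    derivatives.\<close>
  obtain g' where g': "\<And>z. z \<in> ball a r \<Longrightarrow>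
      ((\<lambda>z. \<Sum>\<^sub>\<infinity>n\<in>A. f n z) has_field_derivative g' z) (at z) \<and> ((\<lambda>X. \<Sum>n\<in>X. deriv (f n) z) \<longlongrightarrow> g' z) ?F"
    by (rule has_complex_derivative_uniform_limit[OF ev ulim]) (use r in auto)
  show "(\<lambda>z. \<Sum>\<^sub>\<infinity>n\<in>A. f n z) holomorphic_on ball a r"
    unfolding holomorphic_on_open[OF open_ball] using g' by blast
  have "((\<lambda>n. deriv (f n) a) has_sum g' a) A"
    using g'[of a] r by (simp add: has_sum_def)
  thus "((\<lambda>z. \<Sum>\<^sub>\<infinity>n\<in>A. f n z) has_field_derivative (\<Sum>\<^sub>\<infinity>n\<in>A. deriv (f n) a)) (at a)"
    using g'[of a] r by (simp add: infsumI)
qed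

section \<open>Telescoping of lattice sums by inclusion-exclusion\<close>

lemma has_sum_sum:
  fixes f :: "'b \<Rightarrow> 'a \<Rightarrow> 'c :: topological_comm_monoid_add"
  assumes "\<And>i. i \<in> I \<Longrightarrow> (f i has_sum s i) A"
  shows "((\<lambda>x. \<Sum>i\<in>I. f i x) has_sum (\<Sum>i\<in>I. s i)) A"
  using assms by (induction I rule: infinite_finite_induct) (auto intro: has_sum_add)

lemma summable_on_sum:
  fixes f :: "'b \<Rightarrow> 'a \<Rightarrow> 'c :: topological_comm_monoid_add"
  assumes "\<And>i. i \<in> I \<Longrightarrow> f i summable_on A"
  shows "(\<lambda>x. \<Sum>i\<in>I. f i x) summable_on A"
  using assms by (induction I rule: infinite_finite_induct) (auto intro: summable_on_add)

text \<open>The sum is the expansion of the product of \<open>(if P i then 1 else 0) - 1\<close>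
  over \<open>A\<close>, which has a vanishing factor. It will be used with \<open>P i\<close>
  saying that the entry \<open>n i\<close> is positive.\<close>

lemma sum_Pow_indicator:
  assumes "finite A" "i \<in> A" "P i"
  shows "(\<Sum>S\<in>Pow A. (-1) ^ (card A - card S) * (if \<forall>i\<in>S. P i then 1 else 0 :: 'a :: comm_ring_1)) = 0"
proof -
  have "(\<Prod>i\<in>A. (if P i then 1 else 0) - (1::'a)) =
          (\<Sum>S\<in>Pow A. (-1) ^ (card A - card S) * (\<Prod>i\<in>S. if P i then 1 else 0) * (\<Prod>i\<in>A-S. 1))"
    by (rule prod_diff_conv_sum') fact
  also have "\<dots> = (\<Sum>S\<in>Pow A. (-1) ^ (card A - card S) * (if \<forall>i\<in>S. P i then 1 else 0))"
  proof (rule sum.cong)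
    fix S assume "S \<in> Pow A"
    hence S: "S \<subseteq> A" "finite S" using assms finite_subset by auto
    have "(\<Prod>i\<in>S. if P i then 1 else (0::'a)) = (if \<forall>i\<in>S. P i then 1 else 0)"
      using S(2) by (induction S rule: finite_induct) auto
    thus "(-1) ^ (card A - card S) * (\<Prod>i\<in>S. if P i then 1 else 0) * (\<Prod>i\<in>A-S. 1) =
            (-1) ^ (card A - card S) * (if \<forall>i\<in>S. P i then 1 else (0::'a))"
      using S by (simp add: card_Diff_subset)
  qed auto
  also have "(\<Prod>i\<in>A. (if P i then 1 else 0) - (1::'a)) = 0"
    using assms by (intro prod_zero) auto
  finally show ?thesis by simp
qed

text \<open>Translating the argument by a partial sum of the \<open>w i\<close> amounts to shifting
  the index, so translated lattice sums can be reindexed.\<close>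

lemma lincomb_add_indicator:
  assumes "S \<subseteq> {1..d}"
  shows "lincomb d (\<lambda>i\<in>{1..d}. n i + (if i \<in> S then 1 else 0)) w = lincomb d n w + (\<Sum>i\<in>S. w i)"
proof -
  have "(\<Sum>i=1..d. (if i \<in> S then w i else 0)) = (\<Sum>i\<in>S. w i)"
    using assms by (simp add: Int_absorb1 flip: sum.inter_restrict)
  thus ?thesis
    by (simp add: lincomb_def algebra_simps sum.distrib if_distrib[of "\<lambda>x. _ * x"] if_distrib[of of_nat] cong: if_cong)
qed

text \<open>This is the mixed forward difference
  \<open>\<Prod>\<^sub>i (exp (w\<^sub>i D) - 1)\<close> applied to \<open>g\<close> at
  \<open>y\<close>, expanded over subsets.\<close>

definition fdiff :: "nat \<Rightarrow> (nat \<Rightarrow> complex) \<Rightarrow> (complex \<Rightarrow> complex) \<Rightarrow> complex \<Rightarrow> complex" where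
  "fdiff d w g y = (\<Sum>S\<in>Pow {1..d}. (-1) ^ (d - card S) * g (y + (\<Sum>i\<in>S. w i)))"

lemma G_op_eq_fdiff: "G_op d (\<lambda>x. g (y + x)) w = fdiff d w g y"
  unfolding G_op_def F_op_def fdiff_def by (subst (2) sum.remove[of _ "{}"]) auto

lemma fdiff_0: "fdiff d w g 0 = (-1) ^ d * g 0 + F_op d g w"
  using G_op_eq_fdiff[of d g 0 w] by (simp add: G_op_def)

text \<open>
  With \<open>g\<close> replaced by zero at \<open>0\<close>, the full alternating sum over \<open>\<nat>\<^sub>0\<^sup>d\<close> telescopes to zero by
  inclusion-exclusion over the support of \<open>n\<close>; its term at \<open>n = 0\<close> is \<open>F\<close>.
\<close>
lemma has_sum_fdiff_telescope:
  assumes sm: "(\<lambda>n. g (lincomb d n w)) summable_on nonzero_indices d"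
  assumes nz: "\<And>n. n \<in> nonzero_indices d \<Longrightarrow> lincomb d n w \<noteq> 0"
  assumes nzS: "\<And>S. S \<subseteq> {1..d} \<Longrightarrow> S \<noteq> {} \<Longrightarrow> (\<Sum>i\<in>S. w i) \<noteq> 0"
  shows "((\<lambda>n. fdiff d w g (lincomb d n w)) has_sum - F_op d g w) (nonzero_indices d)"
proof -
  define I where "I = ({1..d} \<rightarrow>\<^sub>E (UNIV :: nat set))"
  define z where "z = (\<lambda>i\<in>{1..d}. 0 :: nat)"
  define g0 where "g0 = (\<lambda>x. if x = 0 then 0 else g x)"
  have g0_0: "g0 0 = 0" by (simp add: g0_def)
  have I: "I = insert z (nonzero_indices d)" "z \<notin> nonzero_indices d"
    by (auto simp: I_def z_def nonzero_indices_def)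
  have lz: "lincomb d z w = 0"
    by (simp add: lincomb_def z_def)
  have "(\<lambda>n. g0 (lincomb d n w)) summable_on nonzero_indices d"
    using sm by (rule summable_on_cong[THEN iffD1, rotated]) (use nz in \<open>auto simp: g0_def\<close>)
  hence smI: "(\<lambda>n. g0 (lincomb d n w)) summable_on I"
    by (simp add: I summable_on_insert_iff)
  define sh where "sh = (\<lambda>S n. \<lambda>i\<in>{1..d}. n i + (if i \<in> S then 1 else (0::nat)))"
  define ind where "ind = (\<lambda>S (n :: nat \<Rightarrow> nat). if \<forall>i\<in>S. n i > 0 then 1 else (0 :: complex))"
  \<comment> \<open>The shift by \<open>S\<close> maps \<open>I\<close> bijectively onto the indices
    that are positive on \<open>S\<close>. Hence the translated sum equals the original one weighted
    by the indicator \<open>ind S\<close>.\<close>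
  have *: "\<exists>a. ((\<lambda>n. g0 (lincomb d n w + (\<Sum>i\<in>S. w i))) has_sum a) I \<and>
           ((\<lambda>n. ind S n * g0 (lincomb d n w)) has_sum a) I" if S: "S \<subseteq> {1..d}" for S
  proof -
    define J where "J = {n\<in>I. \<forall>i\<in>S. n i > 0}"
    have "(\<lambda>n. g0 (lincomb d n w)) summable_on J"
      using smI by (rule summable_on_subset_banach) (auto simp: J_def)
    then obtain a where a: "((\<lambda>n. g0 (lincomb d n w)) has_sum a) J"
      by (auto simp: summable_on_def)
    have "((\<lambda>n. ind S n * g0 (lincomb d n w)) has_sum a) I"
    proof (subst has_sum_cong_neutral)
      show "((\<lambda>n. g0 (lincomb d n w)) has_sum a) J" by fact
    qed (auto simp: J_def ind_def)
    moreover have "((\<lambda>n. g0 (lincomb d (sh S n) w)) has_sum a) I"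
    proof -
      let ?i = "\<lambda>n. \<lambda>i\<in>{1..d}. n i - (if i \<in> S then 1 else (0::nat))"
      have 1: "?i (sh S n) = n" if "n \<in> I" for n
        using that by (intro ext) (auto simp: sh_def I_def restrict_def dest: PiE_arb)
      have 2: "sh S n \<in> J" if "n \<in> I" for n
        using S by (auto simp: sh_def J_def I_def)
      have 3: "sh S (?i n) = n" if n: "n \<in> J" for n
      proof
        fix i
        show "sh S (?i n) i = n i"
          using n by (auto simp: sh_def J_def I_def restrict_def dest: PiE_arb)
      qed
      have 4: "?i n \<in> I" for n
        by (auto simp: I_def)
      have "bij_betw (sh S) I J"
        using 1 2 3 4 by (intro bij_betwI[of _ _ _ ?i]) auto
      thus ?thesis
        using a by (simp add: has_sum_reindex_bij_betw[of "sh S" I J "\<lambda>n. g0 (lincomb d n w)"])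
    qed
    ultimately show ?thesis
      unfolding sh_def lincomb_add_indicator[OF S] by blast
  qed
  have "\<exists>a. \<forall>S\<in>Pow {1..d}. ((\<lambda>n. g0 (lincomb d n w + (\<Sum>i\<in>S. w i))) has_sum a S) I \<and>
           ((\<lambda>n. ind S n * g0 (lincomb d n w)) has_sum a S) I"
    by (intro bchoice) (use * in blast)
  then obtain a where a: "\<And>S. S \<in> Pow {1..d} \<Longrightarrow> ((\<lambda>n. g0 (lincomb d n w + (\<Sum>i\<in>S. w i))) has_sum a S) I"
           "\<And>S. S \<in> Pow {1..d} \<Longrightarrow> ((\<lambda>n. ind S n * g0 (lincomb d n w)) has_sum a S) I"
    by blast
  have sum1: "((\<lambda>n. fdiff d w g0 (lincomb d n w)) has_sum (\<Sum>S\<in>Pow {1..d}. (-1) ^ (d - card S) * a S)) I"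
    unfolding fdiff_def by (intro has_sum_sum has_sum_cmult_right a)
  have "((\<lambda>n. \<Sum>S\<in>Pow {1..d}. (-1) ^ (d - card S) * (ind S n * g0 (lincomb d n w))) has_sum
           (\<Sum>S\<in>Pow {1..d}. (-1) ^ (d - card S) * a S)) I"
    by (intro has_sum_sum has_sum_cmult_right a)
  \<comment> \<open>For \<open>n\<close> other than \<open>z\<close> the alternating sum of
    indicators vanishes because some entry is positive; at \<open>z\<close> the factor
    \<open>g0 0 = 0\<close> does it.\<close>
  moreover have "(\<Sum>S\<in>Pow {1..d}. (-1) ^ (d - card S) * (ind S n * g0 (lincomb d n w))) = 0" if "n \<in> I" for n
  proof (cases "n = z")
    case False
    have "n = z" if "\<And>i. i \<in> {1..d} \<Longrightarrow> n i = 0"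
      using \<open>n \<in> I\<close> that by (intro ext) (auto simp: z_def I_def restrict_def dest: PiE_arb)
    with False obtain i where i: "i \<in> {1..d}" "n i > 0"
      by auto
    have "(\<Sum>S\<in>Pow {1..d}. (-1) ^ (d - card S) * ind S n) = 0"
      using sum_Pow_indicator[of "{1..d}" i "\<lambda>i. n i > 0", where ?'a = complex] i by (simp add: ind_def)
    thus ?thesis
      by (simp flip: mult.assoc sum_distrib_right)
  qed (simp add: lz g0_def)
  ultimately have "((\<lambda>n. 0) has_sum (\<Sum>S\<in>Pow {1..d}. (-1) ^ (d - card S) * a S)) I"
    by (subst (asm) has_sum_cong) auto
  hence "(\<Sum>S\<in>Pow {1..d}. (-1) ^ (d - card S) * a S) = 0"
    using has_sum_unique has_sum_0_simp by blast
  with sum1 have "((\<lambda>n. fdiff d w g0 (lincomb d n w)) has_sum 0) I" by simp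
  moreover have "((\<lambda>n. fdiff d w g0 (lincomb d n w)) has_sum F_op d g w) {z}"
  proof (rule has_sum_finiteI)
    have "F_op d g0 w = F_op d g w"
      unfolding F_op_def using nzS by (intro sum.cong) (auto simp: g0_def)
    thus "F_op d g w = (\<Sum>n\<in>{z}. fdiff d w g0 (lincomb d n w))"
      using g0_0 by (simp add: lz fdiff_0)
  qed auto
  ultimately have "((\<lambda>n. fdiff d w g0 (lincomb d n w)) has_sum 0 - F_op d g w) (I - {z})"
    by (rule has_sum_Diff) (auto simp: I)
  also have "I - {z} = nonzero_indices d"
    using I by auto
  finally have **: "((\<lambda>n. fdiff d w g0 (lincomb d n w)) has_sum - F_op d g w) (nonzero_indices d)"
    by simp
  \<comment> \<open>A nonzero index stays nonzero after a shift, so the modified value of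
    \<open>g0\<close> at 0 is never met.\<close>
  have "fdiff d w g0 (lincomb d n w) = fdiff d w g (lincomb d n w)" if n: "n \<in> nonzero_indices d" for n
    unfolding fdiff_def
  proof (rule sum.cong)
    fix S assume "S \<in> Pow {1..d}"
    hence S: "S \<subseteq> {1..d}" by auto
    have "sh S n \<in> nonzero_indices d"
    proof -
      have "n = z" if eq: "sh S n = z"
      proof
        fix i
        show "n i = z i"
          using n fun_cong[OF eq, of i] unfolding nonzero_indices_def
          by (cases "i \<in> {1..d}") (auto simp: sh_def z_def dest: PiE_arb)
      qed
      moreover have "n \<noteq> z" using n I by auto
      moreover have "sh S n \<in> I" by (auto simp: sh_def I_def)
      ultimately show ?thesis using I by auto
    qed
    from nz[OF this] show "(-1) ^ (d - card S) * g0 (lincomb d n w + (\<Sum>i\<in>S. w i)) =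
                           (-1) ^ (d - card S) * g (lincomb d n w + (\<Sum>i\<in>S. w i))"
      unfolding sh_def lincomb_add_indicator[OF S] by (simp add: g0_def)
  qed auto
  with ** show ?thesis
    by (subst (asm) has_sum_cong) auto
qed

section \<open>Bernoulli numbers as power series coefficients\<close>

text \<open>The symbol of the operator \<open>fdiff\<close>, with \<open>fps_X\<close> in the role
  of \<open>D\<close>.\<close>

definition exp_diff_fps :: "nat \<Rightarrow> (nat \<Rightarrow> complex) \<Rightarrow> complex fps" where
  "exp_diff_fps d w = (\<Prod>i=1..d. fps_exp (w i) - 1)"

text \<open>The series of \<open>\<Prod>\<^sub>i z / (exp (w\<^sub>i z) - 1)\<close>. The shift
  divides out the zero at the origin before inverting; the new constant term \<open>w i\<close>
  makes the factor invertible when \<open>w i\<close> is nonzero.\<close>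

definition todd_fps :: "nat \<Rightarrow> (nat \<Rightarrow> complex) \<Rightarrow> complex fps" where
  "todd_fps d w = (\<Prod>i=1..d. inverse (fps_shift 1 (fps_exp (w i) - 1)))"

lemma exp_diff_fps_altdef: "exp_diff_fps d w = (\<Prod>i=1..d. fps_shift 1 (fps_exp (w i) - 1)) * fps_X ^ d"
proof -
  have "fps_exp a - 1 = fps_shift 1 (fps_exp a - 1) * fps_X" for a :: complex
    by (rule fps_ext) (auto simp: fps_mult_fps_X_commute[symmetric])
  hence "exp_diff_fps d w = (\<Prod>i=1..d. fps_shift 1 (fps_exp (w i) - 1) * fps_X)"
    unfolding exp_diff_fps_def by (intro prod.cong) auto
  thus ?thesis
    by (simp add: prod.distrib)
qed

lemma todd_fps_mult_exp_diff_fps: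
  assumes "\<And>i. i \<in> {1..d} \<Longrightarrow> w i \<noteq> 0"
  shows "todd_fps d w * exp_diff_fps d w = fps_X ^ d"
proof -
  have "todd_fps d w * (\<Prod>i=1..d. fps_shift 1 (fps_exp (w i) - 1)) = 1"
    unfolding todd_fps_def prod.distrib[symmetric]
    by (rule prod.neutral) (use assms in \<open>auto intro!: inverse_mult_eq_1\<close>)
  thus ?thesis
    by (simp add: exp_diff_fps_altdef flip: mult.assoc)
qed

lemma fps_nth_0_prod: "fps_nth (\<Prod>i\<in>A. f i) 0 = (\<Prod>i\<in>A. fps_nth (f i) 0)"
  by (induction A rule: infinite_finite_induct) auto

lemma todd_fps_nth_0: "fps_nth (todd_fps d w) 0 = inverse (\<Prod>i=1..d. w i)"
  by (simp add: todd_fps_def fps_nth_0_prod prod_inversef[symmetric] o_def)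

text \<open>The symbol is divisible by \<open>fps_X ^ d\<close>, and the constant term of the
  cofactor is the product of the \<open>w i\<close>. Through \<open>fdiff_power\<close> this
  describes the difference operator on polynomials of degree at most \<open>d\<close>.\<close>

lemma exp_mult_exp_diff_fps_nth:
  "k < d \<Longrightarrow> fps_nth (fps_exp y * exp_diff_fps d w) k = 0"
  "fps_nth (fps_exp y * exp_diff_fps d w) d = (\<Prod>i=1..d. w i)"
proof -
  define u where "u = (\<Prod>i=1..d. fps_shift 1 (fps_exp (w i) - 1))"
  have eq: "fps_exp y * exp_diff_fps d w = (fps_exp y * u) * fps_X ^ d"
    by (simp add: exp_diff_fps_altdef u_def mult_ac)
  show "fps_nth (fps_exp y * exp_diff_fps d w) k = 0" if "k < d"
    unfolding eq using that by (simp add: fps_X_power_mult_right_nth)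
  show "fps_nth (fps_exp y * exp_diff_fps d w) d = (\<Prod>i=1..d. w i)"
    unfolding eq by (simp add: fps_X_power_mult_right_nth u_def fps_nth_0_prod)
qed

lemma fps_exp_sum: "finite S \<Longrightarrow> fps_exp (\<Sum>i\<in>S. f i :: complex) = (\<Prod>i\<in>S. fps_exp (f i))"
  by (induction S rule: finite_induct) (auto simp: fps_exp_add_mult)

text \<open>Expanding the symbol over subsets gives a signed sum of exponentials
  \<open>fps_exp (y + (\<Sum>i\<in>S. w i))\<close>, and the \<open>k\<close>-th coefficient of each
  is a \<open>k\<close>-th power over \<open>fact k\<close>.\<close>

lemma fdiff_power: "fdiff d w (\<lambda>x. x ^ k) y / fact k = fps_nth (fps_exp y * exp_diff_fps d w) k"
proof -
  have "exp_diff_fps d w = (\<Sum>S\<in>Pow {1..d}. (-1) ^ (card {1..d} - card S) * (\<Prod>i\<in>S. fps_exp (w i)) * (\<Prod>i\<in>{1..d}-S. 1))"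
    unfolding exp_diff_fps_def by (rule prod_diff_conv_sum') auto
  also have "\<dots> = (\<Sum>S\<in>Pow {1..d}. fps_const ((-1) ^ (d - card S)) * fps_exp (\<Sum>i\<in>S. w i))"
  proof (rule sum.cong)
    fix S assume "S \<in> Pow {1..d}"
    hence "finite S" using finite_subset by auto
    thus "(-1) ^ (card {1..d} - card S) * (\<Prod>i\<in>S. fps_exp (w i)) * (\<Prod>i\<in>{1..d}-S. 1) =
          fps_const ((-1) ^ (d - card S)) * fps_exp (\<Sum>i\<in>S. w i)"
      by (simp add: fps_exp_sum flip: fps_const_power fps_const_neg)
  qed auto
  finally have "fps_exp y * exp_diff_fps d w =
                (\<Sum>S\<in>Pow {1..d}. fps_const ((-1) ^ (d - card S)) * fps_exp (y + (\<Sum>i\<in>S. w i)))"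
    by (simp add: sum_distrib_left fps_exp_add_mult mult_ac)
  hence "fps_nth (fps_exp y * exp_diff_fps d w) k =
           (\<Sum>S\<in>Pow {1..d}. (-1) ^ (d - card S) * ((y + (\<Sum>i\<in>S. w i)) ^ k / fact k))"
    by (simp add: fps_sum_nth)
  thus ?thesis
    by (simp add: fdiff_def sum_divide_distrib)
qed

lemma fdiff_power_less: "k < d \<Longrightarrow> fdiff d w (\<lambda>x. x ^ k) y = 0"
  using fdiff_power[of d w k y] exp_mult_exp_diff_fps_nth(1)[of k d y w] by simp

lemma fdiff_power_eq: "fdiff d w (\<lambda>x. x ^ d) y = fact d * (\<Prod>i=1..d. w i)"
  using fdiff_power[of d w d y] exp_mult_exp_diff_fps_nth(2)[of y d w] by (simp add: field_simps)

text \<open>The difference of the two series sums to 0 off the origin. Since a convergent power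
  series is continuous, its value \<open>b 0 - b' 0\<close> at the origin is 0 too, and uniqueness
  of expansions applies.\<close>

lemma power_series_unique_punctured:
  fixes b b' :: "nat \<Rightarrow> complex"
  assumes "R > 0"
    and "\<And>z. z \<noteq> 0 \<Longrightarrow> norm z < R \<Longrightarrow> (\<lambda>k. b k * z ^ k) sums f z"
    and "\<And>z. z \<noteq> 0 \<Longrightarrow> norm z < R \<Longrightarrow> (\<lambda>k. b' k * z ^ k) sums f z"
  shows "b = b'"
proof -
  define D where "D = Abs_fps (\<lambda>k. b k - b' k)"
  define g where "g = (\<lambda>z :: complex. if z = 0 then b 0 - b' 0 else 0)"
  have "(\<lambda>k. fps_nth D k * z ^ k) sums g z" if "norm z < R" for z
  proof (cases "z = 0")
    case False
    have "(\<lambda>k. b k * z ^ k - b' k * z ^ k) sums (f z - f z)"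
      by (intro sums_diff assms that False)
    thus ?thesis using False by (simp add: D_def g_def ring_distribs)
  qed (simp add: D_def g_def)
  moreover have "eventually (\<lambda>z :: complex. norm z < R) (nhds 0)"
    using eventually_nhds_in_open[of "ball 0 R" "0::complex"] assms(1) by simp
  ultimately have D: "g has_fps_expansion D"
    by (intro has_fps_expansionI) (auto elim: eventually_mono)
  hence "g \<midarrow>0\<rightarrow> g 0"
    by (intro isContD has_fps_expansion_imp_continuous)
  moreover have "g \<midarrow>0\<rightarrow> 0"
    by (rule tendsto_eventually) (auto simp: g_def eventually_at_filter)
  ultimately have "g 0 = 0"
    using LIM_unique by blast
  hence "g = (\<lambda>_. 0)" by (auto simp: g_def)
  with D have "D = 0"
    using fps_expansion_unique_complex has_fps_expansion_0 by blast
  thus ?thesis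
    by (auto simp: D_def fps_eq_iff)
qed

text \<open>After removing the singularity at 0, the function is holomorphic on the whole disc, so
  its Taylor series converges there and not merely near 0.\<close>

lemma generating_function_sums:
  fixes w :: "nat \<Rightarrow> complex"
  assumes d: "d \<ge> 1" and w: "\<And>i. i \<in> {1..d} \<Longrightarrow> w i \<noteq> 0"
  assumes z: "z \<noteq> 0" "norm z < 2 * pi / (MAX i\<in>{1..d}. norm (w i))"
  shows "(\<lambda>k. fps_nth (fps_exp a * todd_fps d w) k * z ^ k) sums
           (z ^ d * exp (a * z) * (\<Prod>i=1..d. 1 / (exp (w i * z) - 1)))"
proof -
  define W where "W = (MAX i\<in>{1..d}. norm (w i))"
  define R where "R = 2 * pi / W"
  have leW: "norm (w i) \<le> W" if "i \<in> {1..d}" for i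
    unfolding W_def using that by (intro Max_ge) auto
  have "norm (w 1) > 0" using w[of 1] d by auto
  also have "norm (w 1) \<le> W" using leW d by auto
  finally have W: "W > 0" .
  define h where "h = (\<lambda>c z. if z = 0 then c else (exp (c * z) - 1) / z :: complex)"
  have h_fps: "h c has_fps_expansion fps_shift 1 (fps_exp c - 1)" for c
  proof (cases "c = 0")
    case True
    thus ?thesis by (simp add: h_def cong: if_cong)
  next
    case False
    have "subdegree (fps_exp c - 1) \<ge> 1"
      by (rule subdegree_geI) (use False in \<open>auto simp: fps_eq_iff intro!: exI[of _ 1]\<close>)
    hence "(\<lambda>x. if x = 0 then c else (exp (c * x) - 1) / x ^ 1) has_fps_expansion fps_shift 1 (fps_exp c - 1)"
      by (intro has_fps_expansion_shift fps_expansion_intros) auto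
    thus ?thesis unfolding h_def power_one_right .
  qed
  have h_hol: "h c holomorphic_on A" for c A
  proof -
    have "h c analytic_on {x}" for x
    proof (cases "x = 0")
      case True
      thus ?thesis using h_fps has_fps_expansion_imp_analytic_0 by blast
    next
      case False
      have "(\<lambda>z. (exp (c * z) - 1) / z) holomorphic_on -{0}"
        by (auto intro!: holomorphic_intros)
      hence "h c holomorphic_on -{0}"
        by (rule holomorphic_transform) (auto simp: h_def)
      thus ?thesis using False by (auto simp: analytic_at)
    qed
    hence "h c analytic_on A" by (subst analytic_on_analytic_at) auto
    thus ?thesis by (rule analytic_imp_holomorphic)
  qed
  define g where "g = (\<lambda>z. exp (a * z) * (\<Prod>i=1..d. inverse (h (w i) z)))"
  have g_fps: "g has_fps_expansion fps_exp a * todd_fps d w"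
    unfolding g_def todd_fps_def
    by (intro fps_expansion_intros h_fps) (use w in auto)
  \<comment> \<open>A zero of \<open>exp (w i * x) - 1\<close> has \<open>w i * x\<close> in the
    integer multiples of \<open>2 * pi * \<i>\<close>; the radius leaves only the multiple 0, where
    \<open>h\<close> takes the value \<open>w i\<close>.\<close>
  have nz: "h (w i) x \<noteq> 0" if "i \<in> {1..d}" "norm x < R" for i x
  proof (cases "x = 0")
    case False
    have "exp (w i * x) \<noteq> 1"
    proof
      assume "exp (w i * x) = 1"
      then obtain n :: int where n: "Re (w i * x) = 0" "Im (w i * x) = of_int (2 * n) * pi"
        by (subst (asm) exp_eq_1) auto
      have "norm (w i * x) < 2 * pi"
      proof -
        have "norm (w i * x) \<le> W * norm x"
          using leW[OF that(1)] by (simp add: norm_mult mult_right_mono)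
        also have "\<dots> < 2 * pi" using that(2) W by (simp add: R_def field_simps)
        finally show ?thesis .
      qed
      moreover have "2 * \<bar>of_int n\<bar> * pi \<le> norm (w i * x)"
        using abs_Im_le_cmod[of "w i * x"] n by (simp add: abs_mult)
      ultimately have "2 * \<bar>of_int n\<bar> * pi < 2 * pi" by linarith
      hence "\<bar>real_of_int n\<bar> < 1" by simp
      hence "n = 0" by linarith
      hence "w i * x = 0" using n by (simp add: complex_eq_iff)
      thus False using w[OF that(1)] False by simp
    qed
    thus ?thesis using False by (simp add: h_def)
  qed (use w that in \<open>auto simp: h_def\<close>)
  have "g holomorphic_on eball 0 (ereal R)"
    unfolding g_def using nz by (auto intro!: holomorphic_intros h_hol)
  hence "(\<lambda>k. fps_nth (fps_exp a * todd_fps d w) k * z ^ k) sums g z"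
    using z by (intro has_fps_expansion_imp_sums_complex[OF g_fps, of "ereal R"]) (auto simp: R_def W_def)
  also have "g z = z ^ d * exp (a * z) * (\<Prod>i=1..d. 1 / (exp (w i * z) - 1))"
    using z by (simp add: g_def h_def prod_dividef)
  finally show ?thesis .
qed

text \<open>Resolves the definite description: the generating function supplies existence,
  uniqueness on the punctured disc supplies the rest. The product of the \<open>w i\<close> accounts
  for the numerators absent from \<open>todd_fps\<close>.\<close>

lemma bernoulli_barnes_eq:
  assumes d: "d \<ge> 1" and w: "\<And>i. i \<in> {1..d} \<Longrightarrow> w i \<noteq> 0"
  shows "bernoulli_barnes d w n a = fact n * (\<Prod>i=1..d. w i) * fps_nth (fps_exp a * todd_fps d w) n"
proof -
  define P where "P = (\<Prod>i=1..d. w i)"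
  let ?R = "2 * pi / (MAX i\<in>{1..d}. norm (w i))"
  define b where "b = (\<lambda>n. fact n * P * fps_nth (fps_exp a * todd_fps d w) n)"
  have "norm (w 1) > 0" using w[of 1] d by auto
  also have "norm (w 1) \<le> (MAX i\<in>{1..d}. norm (w i))"
    using d by (intro Max_ge) auto
  finally have R: "?R > 0" by simp
  have b: "(\<lambda>k. b k * z ^ k / fact k) sums
          (z ^ d * exp (a * z) * (\<Prod>i=1..d. w i / (exp (w i * z) - 1)))" if "z \<noteq> 0" "norm z < ?R" for z
    using sums_mult[OF generating_function_sums[OF d w that, of a], of P]
    by (simp add: b_def mult_ac P_def prod_dividef)
  have "(THE b. \<forall>z. z \<noteq> 0 \<and> norm z < ?R \<longrightarrow>
      (\<lambda>k. b k * z ^ k / fact k) sums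
          (z ^ d * exp (a * z) * (\<Prod>i=1..d. w i / (exp (w i * z) - 1)))) = b"
  proof (rule the_equality)
    fix b' assume b': "\<forall>z. z \<noteq> 0 \<and> norm z < ?R \<longrightarrow>
      (\<lambda>k. b' k * z ^ k / fact k) sums
          (z ^ d * exp (a * z) * (\<Prod>i=1..d. w i / (exp (w i * z) - 1)))"
    have "(\<lambda>k. b' k / fact k) = (\<lambda>k. b k / fact k)"
      by (rule power_series_unique_punctured[OF R,
            of _ "\<lambda>z. z ^ d * exp (a * z) * (\<Prod>i=1..d. w i / (exp (w i * z) - 1))"])
         (use b b' in auto)
    thus "b' = b" by (auto simp: fun_eq_iff)
  qed (use b in auto)
  thus ?thesis
    unfolding bernoulli_barnes_def by (simp add: b_def P_def)
qed

section \<open>Bernoullian functions as explicit polynomials\<close>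

lemma pderiv_eqD:
  fixes p q :: "'a :: {idom, ring_char_0} poly"
  assumes "pderiv p = pderiv q" "poly p 0 = poly q 0"
  shows "p = q"
proof -
  have "pderiv (p - q) = 0" using assms by (simp add: pderiv_diff)
  hence "degree (p - q) = 0" by (simp add: pderiv_eq_0_iff)
  then obtain c where "p - q = [:c:]" by (rule degree_eq_zeroE)
  moreover have "poly (p - q) 0 = 0" using assms by simp
  ultimately show ?thesis by simp
qed

text \<open>Multiplying out \<open>fps_exp a * todd_fps d w\<close> shows the prescribed derivative
  to be a polynomial \<open>q\<close> in \<open>a\<close>, and \<open>p\<close> is its
  antiderivative vanishing at 0. The \<open>d\<close>-th derivative at 0 reads off the coefficient
  of degree \<open>d\<close>.\<close>

lemma higher_pderiv_bernoullian_0: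
  assumes d: "d \<ge> 1" and w: "\<And>i. i \<in> {1..d} \<Longrightarrow> w i \<noteq> 0"
  shows "poly ((pderiv ^^ d) (bernoullian d w m)) 0 = fact m * fps_nth (todd_fps d w) m"
proof -
  define K where "K = m + d - 1"
  define q where "q = (\<Sum>k\<le>K. monom (fact m * fps_nth (todd_fps d w) (K - k) / fact k) k)"
  define p where "p = (\<Sum>k\<le>K. monom (fact m * fps_nth (todd_fps d w) (K - k) / fact (Suc k)) (Suc k))"
  have pq: "pderiv p = q"
    unfolding p_def q_def higher_pderiv_sum[of 1, simplified] pderiv_monom
    by (intro sum.cong arg_cong2[of _ _ _ _ monom]) (simp_all add: fact_Suc del: of_nat_Suc)
  have p0: "poly p 0 = 0"
    by (simp add: p_def poly_sum poly_monom)
  have q: "poly q a = fact m / (fact K * (\<Prod>i=1..d. w i)) * bernoulli_barnes d w K a" for a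
  proof -
    have "(\<Prod>i=1..d. w i) \<noteq> 0" using w by simp
    moreover have "bernoulli_barnes d w K a =
        fact K * (\<Prod>i=1..d. w i) * (\<Sum>k\<le>K. a ^ k / fact k * fps_nth (todd_fps d w) (K - k))"
      by (subst bernoulli_barnes_eq) (use d w in \<open>simp_all add: fps_mult_nth atLeast0AtMost\<close>)
    ultimately have "fact m / (fact K * (\<Prod>i=1..d. w i)) * bernoulli_barnes d w K a =
        fact m * (\<Sum>k\<le>K. a ^ k / fact k * fps_nth (todd_fps d w) (K - k))"
      by simp
    also have "\<dots> = poly q a"
      by (simp add: q_def poly_sum poly_monom sum_distrib_left mult_ac)
    finally show ?thesis ..
  qed
  have "bernoullian d w m = p"
    unfolding bernoullian_def
  proof (rule the_equality)
    show "poly p 0 = 0 \<and> (\<forall>a. poly (pderiv p) a =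
           fact m / (fact (m + d - 1) * (\<Prod>i=1..d. w i)) * bernoulli_barnes d w (m + d - 1) a)"
      using p0 q pq by (simp add: K_def)
    fix p' assume p': "poly p' 0 = 0 \<and> (\<forall>a. poly (pderiv p') a =
           fact m / (fact (m + d - 1) * (\<Prod>i=1..d. w i)) * bernoulli_barnes d w (m + d - 1) a)"
    hence "poly (pderiv p') = poly (pderiv p)"
      using q pq by (simp add: K_def fun_eq_iff)
    hence "pderiv p' = pderiv p" by (simp only: poly_eq_poly_eq_iff)
    moreover have "poly p' 0 = poly p 0" using p' p0 by (simp only:)
    ultimately show "p' = p" by (rule pderiv_eqD)
  qed
  moreover have "poly ((pderiv ^^ d) p) 0 = fact d * coeff p d"
    by (simp add: poly_0_coeff_0 coeff_higher_pderiv pochhammer_fact)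
  moreover have "coeff p d = fact m * fps_nth (todd_fps d w) m / fact d"
  proof -
    \<comment> \<open>Only \<open>k = d - 1\<close> contributes to degree \<open>d\<close>, and
      \<open>K - (d - 1) = m\<close>.\<close>
    have "coeff p d = (\<Sum>k\<le>K. if k = d - 1 then fact m * fps_nth (todd_fps d w) (K - k) / fact (Suc k) else 0)"
      unfolding p_def coeff_sum by (intro sum.cong) (use d in auto)
    also have "\<dots> = fact m * fps_nth (todd_fps d w) m / fact d"
      using d by (simp add: K_def sum.delta)
    finally show ?thesis .
  qed
  ultimately show ?thesis by simp
qed

section \<open>Powers on the half-plane and the difference operator\<close>

locale barnes_setup =
  fixes d :: nat and \<theta> :: real and lg :: "complex \<Rightarrow> complex" and w :: "nat \<Rightarrow> complex"
  assumes d: "d \<ge> 1"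
    and lg: "log_branch \<theta> lg"
    and w: "\<And>i. i \<in> {1..d} \<Longrightarrow> w i \<in> half_plane \<theta>"
begin

abbreviation "hp \<equiv> half_plane \<theta>"

text \<open>The signed distance to the boundary line of the half-plane: real-linear, and a lower
  bound for the norm.\<close>

definition \<rho> :: "complex \<Rightarrow> real" where
  "\<rho> z = Re (cis (-\<theta>) * z)"

lemma hp_iff: "z \<in> hp \<longleftrightarrow> \<rho> z > 0"
  by (simp add: half_plane_iff \<rho>_def)

lemma \<rho>_add: "\<rho> (x + y) = \<rho> x + \<rho> y"
  by (simp add: \<rho>_def algebra_simps)

lemma \<rho>_scale: "\<rho> (of_real c * x) = c * \<rho> x"
  by (simp add: \<rho>_def algebra_simps)

lemma \<rho>_sum: "\<rho> (\<Sum>i\<in>A. f i) = (\<Sum>i\<in>A. \<rho> (f i))"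
  by (simp add: \<rho>_def sum_distrib_left)

lemma \<rho>_le_norm: "\<rho> z \<le> norm z"
  unfolding \<rho>_def using complex_Re_le_cmod[of "cis (-\<theta>) * z"] by (simp add: norm_mult)

lemma exp_lg: "z \<in> hp \<Longrightarrow> exp (lg z) = z"
  using lg by (simp add: log_branch_def)

lemma hp_nonzero: "z \<in> hp \<Longrightarrow> z \<noteq> 0"
  by (auto simp: half_plane_iff)

lemma w_nonzero: "i \<in> {1..d} \<Longrightarrow> w i \<noteq> 0"
  using w hp_nonzero by blast

text \<open>Differentiating the identity \<open>exp (lg z) = z\<close> determines the derivative for
  any branch.\<close>

lemma DERIV_lg:
  assumes "z \<in> hp"
  shows "(lg has_field_derivative 1 / z) (at z)"
proof -
  have lg': "(lg has_field_derivative deriv lg z) (at z)"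
    using lg assms open_half_plane by (auto simp: log_branch_def intro: holomorphic_derivI)
  have "((\<lambda>z. exp (lg z)) has_field_derivative exp (lg z) * deriv lg z) (at z)"
    by (rule DERIV_fun_exp[OF lg'])
  moreover have "((\<lambda>z. exp (lg z)) has_field_derivative 1) (at z)"
    by (rule has_field_derivative_transform_within_open[OF DERIV_ident open_half_plane assms])
       (simp add: exp_lg)
  ultimately have "exp (lg z) * deriv lg z = 1"
    by (rule DERIV_unique)
  hence "deriv lg z = 1 / z"
    using assms hp_nonzero by (auto simp: exp_lg field_simps)
  with lg' show ?thesis by simp
qed

text \<open>On the convex half-plane \<open>lg\<close> and the principal logarithm of the rotated
  argument have equal derivatives, so they differ by a constant. The bound controls the factor that
  a complex exponent adds to the norm of a power.\<close>

lemma Im_lg_bounded: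
  obtains A where "A \<ge> 0" "\<And>z. z \<in> hp \<Longrightarrow> \<bar>Im (lg z)\<bar> \<le> A"
proof -
  let ?L = "\<lambda>z. Ln (cis (-\<theta>) * z)"
  have "((\<lambda>z. lg z - ?L z) has_field_derivative 0) (at z within hp)" if "z \<in> hp" for z
  proof -
    have "cis (-\<theta>) * z \<notin> \<real>\<^sub>\<le>\<^sub>0"
      using that unfolding half_plane_iff by (auto simp: complex_nonpos_Reals_iff)
    hence "((\<lambda>z. lg z - ?L z) has_field_derivative 1 / z - inverse (cis (-\<theta>) * z) * cis (-\<theta>)) (at z)"
      by (auto intro!: derivative_eq_intros DERIV_lg that)
    also have "1 / z - inverse (cis (-\<theta>) * z) * cis (-\<theta>) = 0"
    proof -
      have "1 / z - inverse (k * z) * k = 0" if "k \<noteq> 0" for k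
        using that hp_nonzero[OF \<open>z \<in> hp\<close>] by (simp add: divide_simps)
      thus ?thesis using cis_neq_zero by blast
    qed
    finally show ?thesis by (rule has_field_derivative_at_within)
  qed
  hence "\<exists>c. \<forall>z\<in>hp. lg z - ?L z = c"
    by (rule has_field_derivative_zero_constant[OF convex_half_plane])
  then obtain c where c: "\<And>z. z \<in> hp \<Longrightarrow> lg z - ?L z = c"
    by blast
  show ?thesis
  proof (rule that[of "\<bar>Im c\<bar> + pi / 2"])
    fix z assume z: "z \<in> hp"
    have "lg z = c + ?L z" using c[OF z] by (simp add: algebra_simps)
    moreover have "\<bar>Im (?L z)\<bar> < pi / 2"
      using z unfolding half_plane_iff by (intro Re_Ln_pos_lt_imp)
    ultimately show "\<bar>Im (lg z)\<bar> \<le> \<bar>Im c\<bar> + pi / 2" by simp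
  qed auto
qed

lemma \<rho>_lincomb: "\<rho> (lincomb d n w) = (\<Sum>i=1..d. real (n i) * \<rho> (w i))"
  unfolding lincomb_def \<rho>_sum using \<rho>_scale[of "real _"] by simp

text \<open>The constant is the least of the finitely many positive numbers
  \<open>\<rho> (w i)\<close>. Linear growth reduces lattice sums of powers to sums over the total
  of the entries.\<close>

lemma \<rho>_lincomb_ge:
  obtains c where "c > 0" "\<And>n. \<rho> (lincomb d n w) \<ge> c * real (\<Sum>i=1..d. n i)"
proof -
  define c where "c = Min (\<rho> ` w ` {1..d})"
  have "c \<in> \<rho> ` w ` {1..d}" unfolding c_def using d by (intro Min_in) auto
  hence "c > 0" using w by (auto simp: hp_iff)
  have "c \<le> \<rho> (w i)" if "i \<in> {1..d}" for i
    unfolding c_def using that by (intro Min_le) auto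
  hence "\<rho> (lincomb d n w) \<ge> (\<Sum>i=1..d. real (n i) * c)" for n
    unfolding \<rho>_lincomb by (intro sum_mono mult_left_mono) auto
  with \<open>c > 0\<close> show ?thesis
    by (intro that[of c]) (simp_all add: sum_distrib_right mult.commute[of c])
qed

lemma lincomb_in_hp: "n \<in> nonzero_indices d \<Longrightarrow> lincomb d n w \<in> hp"
proof -
  assume n: "n \<in> nonzero_indices d"
  obtain c where c: "c > 0" "\<And>n. \<rho> (lincomb d n w) \<ge> c * real (\<Sum>i=1..d. n i)"
    using \<rho>_lincomb_ge by blast
  have "0 < c * real (\<Sum>i=1..d. n i)"
    using c(1) nonzero_indices_sum_ge_1[OF n] by (intro mult_pos_pos) linarith+
  with c(2)[of n] show ?thesis by (auto simp: hp_iff)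
qed

lemma \<rho>_sum_w_nonneg: "S \<subseteq> {1..d} \<Longrightarrow> \<rho> (\<Sum>i\<in>S. w i) \<ge> 0"
  unfolding \<rho>_sum using w by (intro sum_nonneg less_imp_le) (auto simp: hp_iff)

lemma add_sum_w_in_hp: "y \<in> hp \<Longrightarrow> S \<subseteq> {1..d} \<Longrightarrow> y + (\<Sum>i\<in>S. w i) \<in> hp"
  using \<rho>_sum_w_nonneg[of S] by (auto simp: hp_iff \<rho>_add)

lemma sum_w_in_hp: "S \<subseteq> {1..d} \<Longrightarrow> S \<noteq> {} \<Longrightarrow> (\<Sum>i\<in>S. w i) \<in> hp"
  unfolding hp_iff \<rho>_sum using w by (intro sum_pos) (auto simp: hp_iff intro: finite_subset)

lemma norm_exp_mult_lg:
  assumes "z \<in> hp"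
  shows "norm (exp (s * lg z)) = norm z powr Re s * exp (- (Im s * Im (lg z)))"
proof -
  have "norm z = exp (Re (lg z))"
    using exp_lg[OF assms] by (metis norm_exp_eq_Re)
  thus ?thesis
    using hp_nonzero[OF assms] by (simp add: norm_exp_eq_Re powr_def exp_diff exp_minus field_simps)
qed

text \<open>A majorant uniform in \<alpha> near \<open>a\<close> and in all points \<open>t\<close>
  at least as deep in the half-plane as the lattice point. The freedom in \<open>t\<close> is needed
  for Taylor remainders along segments.\<close>

lemma power_bound:
  assumes p: "continuous_on UNIV p" and a: "Re a > real d - real k"
  obtains r M where "r > 0" "M summable_on nonzero_indices d"
    "\<And>\<alpha> n t. \<alpha> \<in> cball a r \<Longrightarrow> n \<in> nonzero_indices d \<Longrightarrow> \<rho> (lincomb d n w) \<le> \<rho> t \<Longrightarrow>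
       norm (p \<alpha> * exp ((- \<alpha> - of_nat k) * lg t) :: complex) \<le> M n"
proof -
  \<comment> \<open>Half of the excess over the critical exponent: on the closed disc
    \<open>Re \<alpha> + k\<close> stays at least \<open>d + r\<close>, which is \<sigma>.\<close>
  define r where "r = (Re a + real k - real d) / 2"
  define \<sigma> where "\<sigma> = real d + r"
  have r: "r > 0" using a by (simp add: r_def)
  have \<sigma>: "\<sigma> > real d" using r by (simp add: \<sigma>_def)
  obtain c where c: "c > 0" "\<And>n. \<rho> (lincomb d n w) \<ge> c * real (\<Sum>i=1..d. n i)"
    using \<rho>_lincomb_ge by blast
  obtain A where A: "A \<ge> 0" "\<And>z. z \<in> hp \<Longrightarrow> \<bar>Im (lg z)\<bar> \<le> A"
    using Im_lg_bounded by blast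
  \<comment> \<open>All factors depending only on \<alpha> are collected here and bounded by
    compactness of the disc.\<close>
  define q where "q = (\<lambda>\<alpha>. norm (p \<alpha>) * exp (\<bar>Im \<alpha>\<bar> * A) * c powr (- (Re \<alpha> + real k)))"
  have "continuous_on (cball a r) q"
    unfolding q_def using c(1)
    by (intro continuous_intros continuous_on_subset[OF p]) auto
  hence "compact (q ` cball a r)"
    by (intro compact_continuous_image) auto
  then obtain B where B: "\<And>\<alpha>. \<alpha> \<in> cball a r \<Longrightarrow> q \<alpha> \<le> B"
    using compact_imp_bounded bounded_real by (metis abs_le_D1 imageI)
  define M where "M = (\<lambda>n. B * real (\<Sum>i=1..d. n i) powr (-\<sigma>))"
  show ?thesis
  proof (rule that[of r M])
    show "M summable_on nonzero_indices d"
      unfolding M_def by (intro summable_on_cmult_right summable_on_powr_nonzero_indices d \<sigma>)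
    fix \<alpha> n t
    assume \<alpha>: "\<alpha> \<in> cball a r" and n: "n \<in> nonzero_indices d" and t: "\<rho> (lincomb d n w) \<le> \<rho> t"
    define X where "X = real (\<Sum>i=1..d. n i)"
    have X: "X \<ge> 1" unfolding X_def using nonzero_indices_sum_ge_1[OF n] by linarith
    have "t \<in> hp" using lincomb_in_hp[OF n] t by (auto simp: hp_iff)
    define s where "s = Re \<alpha> + real k"
    have s: "s \<ge> \<sigma>"
    proof -
      have "\<bar>Re (a - \<alpha>)\<bar> \<le> r"
        using \<alpha> abs_Re_le_cmod[of "a - \<alpha>"] by (simp add: dist_norm)
      hence "Re a - Re \<alpha> \<le> r" by simp
      moreover have "2 * r = Re a + real k - real d" by (simp add: r_def)
      ultimately show ?thesis unfolding s_def \<sigma>_def by linarith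
    qed
    have cX: "c * X > 0" using c X by auto
    have "c * X \<le> norm t" using c(2)[of n] t \<rho>_le_norm[of t] by (simp add: X_def)
    have "norm (exp ((- \<alpha> - of_nat k) * lg t)) = norm t powr (-s) * exp (Im \<alpha> * Im (lg t))"
      using \<open>t \<in> hp\<close> by (subst norm_exp_mult_lg) (simp_all add: s_def)
    also have "\<dots> \<le> (c powr (-s) * X powr (-\<sigma>)) * exp (\<bar>Im \<alpha>\<bar> * A)"
    proof (rule mult_mono)
      have "norm t powr (-s) \<le> (c * X) powr (-s)"
        using cX \<open>c * X \<le> norm t\<close> s \<sigma> by (intro powr_mono2') auto
      also have "\<dots> = c powr (-s) * X powr (-s)" by (simp add: powr_mult)
      also have "\<dots> \<le> c powr (-s) * X powr (-\<sigma>)"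
        using X s by (intro mult_left_mono powr_mono) auto
      finally show "norm t powr (-s) \<le> c powr (-s) * X powr (-\<sigma>)" .
      have "Im \<alpha> * Im (lg t) \<le> \<bar>Im \<alpha>\<bar> * \<bar>Im (lg t)\<bar>"
        by (metis abs_ge_self abs_mult)
      also have "\<dots> \<le> \<bar>Im \<alpha>\<bar> * A"
        using A(2)[OF \<open>t \<in> hp\<close>] by (intro mult_left_mono) auto
      finally show "exp (Im \<alpha> * Im (lg t)) \<le> exp (\<bar>Im \<alpha>\<bar> * A)" by simp
    qed auto
    finally have "norm (p \<alpha>) * norm (exp ((- \<alpha> - of_nat k) * lg t)) \<le>
                    norm (p \<alpha>) * ((c powr (-s) * X powr (-\<sigma>)) * exp (\<bar>Im \<alpha>\<bar> * A))"
      by (intro mult_left_mono) auto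
    also have "\<dots> = q \<alpha> * X powr (-\<sigma>)"
      by (simp add: q_def s_def)
    also have "\<dots> \<le> B * X powr (-\<sigma>)"
      by (intro mult_right_mono B \<alpha>) auto
    finally show "norm (p \<alpha> * exp ((- \<alpha> - of_nat k) * lg t)) \<le> M n"
      by (simp add: norm_mult M_def X_def)
  qed (use r in auto)
qed

text \<open>\<open>hpow \<alpha> j\<close> is the \<open>j\<close>-th derivative of \<open>z \<mapsto> z\<^bsup>d-\<alpha>\<^esup>\<close>; working with it instead of the iterated
  antiderivatives of \<open>z\<^bsup>-\<alpha>\<^esup>\<close> keeps everything entire in \<open>\<alpha>\<close>.\<close>
definition hpow :: "complex \<Rightarrow> nat \<Rightarrow> complex \<Rightarrow> complex" where
  "hpow \<alpha> j z = (\<Prod>i<j. of_nat d - of_nat i - \<alpha>) * exp ((of_nat d - of_nat j - \<alpha>) * lg z)"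

text \<open>The chain rule brings down the exponent, which is the next factor of the product, and
  \<open>1 / z\<close> lowers the exponent by one.\<close>

lemma DERIV_hpow:
  assumes "z \<in> hp"
  shows "(hpow \<alpha> j has_field_derivative hpow \<alpha> (Suc j) z) (at z)"
proof -
  define s where "s = of_nat d - of_nat j - \<alpha>"
  have "exp ((of_nat d - of_nat (Suc j) - \<alpha>) * lg z) = exp (s * lg z - lg z)"
    by (simp add: s_def algebra_simps)
  hence "exp ((of_nat d - of_nat (Suc j) - \<alpha>) * lg z) = exp (s * lg z) / z"
    using exp_lg[OF assms] by (simp add: exp_diff)
  thus ?thesis
    unfolding hpow_def s_def[symmetric]
    by (auto intro!: derivative_eq_intros DERIV_lg assms simp: s_def[symmetric] mult_ac)
qed

section \<open>The truncated inverse operator and its remainder\<close>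

definition b :: "nat \<Rightarrow> complex" where "b = fps_nth (todd_fps d w)"

text \<open>This is \<open>pole_factor \<alpha>\<close> times the function \<psi> of the overview,
  which avoids dividing by factors that vanish at the poles; the error term \<open>R\<close> carries
  the same factor.\<close>

definition \<phi> :: "nat \<Rightarrow> complex \<Rightarrow> complex \<Rightarrow> complex" where
  "\<phi> N \<alpha> z = (\<Sum>m\<le>N. b m * hpow \<alpha> m z)"

definition R :: "nat \<Rightarrow> complex \<Rightarrow> complex \<Rightarrow> complex" where
  "R N \<alpha> y = hpow \<alpha> d y - fdiff d w (\<phi> N \<alpha>) y"

text \<open>
  Applied to Taylor polynomials, the operator \<open>\<Prod>\<^sub>i (exp (w\<^sub>i D) - 1)\<close> composed with
  \<open>\<Sum>\<^sub>m b\<^sub>m D\<^sup>m\<close> acts as \<open>D\<^sup>d\<close>.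
\<close>
lemma fdiff_taylor_polynomial:
  "(\<Sum>S\<in>Pow {1..d}. (-1) ^ (d - card S) * (\<Sum>m\<le>N. b m *
      (\<Sum>k\<le>d+N-m. h (m + k) * (\<Sum>i\<in>S. w i) ^ k / fact k))) = h d"
proof -
  define e where "e = fps_nth (exp_diff_fps d w)"
  define K where "K = d + N"
  have e_eq: "e k = (\<Sum>S\<in>Pow {1..d}. (-1) ^ (d - card S) * (\<Sum>i\<in>S. w i) ^ k / fact k)" for k
    using fdiff_power[of d w k 0] by (simp add: e_def fdiff_def sum_divide_distrib)
  have e0: "e k = 0" if "k < d" for k
    using exp_mult_exp_diff_fps_nth(1)[OF that, of 0 w] by (simp add: e_def)
  have "(\<Sum>S\<in>Pow {1..d}. (-1) ^ (d - card S) * (\<Sum>m\<le>N. b m *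
      (\<Sum>k\<le>K-m. h (m + k) * (\<Sum>i\<in>S. w i) ^ k / fact k))) =
        (\<Sum>S\<in>Pow {1..d}. \<Sum>m\<le>N. \<Sum>k\<le>K-m. b m * h (m + k) * ((-1) ^ (d - card S) * (\<Sum>i\<in>S. w i) ^ k / fact k))"
    by (simp add: sum_distrib_left mult_ac)
  also have "\<dots> = (\<Sum>m\<le>N. \<Sum>S\<in>Pow {1..d}. \<Sum>k\<le>K-m. b m * h (m + k) * ((-1) ^ (d - card S) * (\<Sum>i\<in>S. w i) ^ k / fact k))"
    by (rule sum.swap)
  also have "\<dots> = (\<Sum>m\<le>N. \<Sum>k\<le>K-m. \<Sum>S\<in>Pow {1..d}. b m * h (m + k) * ((-1) ^ (d - card S) * (\<Sum>i\<in>S. w i) ^ k / fact k))"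
    by (intro sum.cong refl sum.swap)
  also have "\<dots> = (\<Sum>m\<le>N. \<Sum>k\<le>K-m. b m * h (m + k) * e k)"
    by (simp add: e_eq sum_distrib_left)
  \<comment> \<open>The added terms have \<open>m > N\<close>, hence
    \<open>k \<le> K - m < d\<close>, where \<open>e k = 0\<close>. On the full triangle, grouping
    by \<open>m + k\<close> produces Cauchy product coefficients.\<close>
  also have "\<dots> = (\<Sum>m\<le>K. \<Sum>k\<le>K-m. b m * h (m + k) * e k)"
    by (rule sum.mono_neutral_left) (auto simp: K_def intro!: sum.neutral e0)
  also have "\<dots> = (\<Sum>(m,k)\<in>Sigma {..K} (\<lambda>m. {..K-m}). b m * h (m + k) * e k)"
    by (rule sum.Sigma) auto
  also have "Sigma {..K} (\<lambda>m. {..K-m}) = {(i,j). i + j \<le> K}"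
    by auto
  also have "(\<Sum>(m,k)\<in>{(i,j). i + j \<le> K}. b m * h (m + k) * e k) =
             (\<Sum>j\<le>K. \<Sum>i\<le>j. b i * h (i + (j - i)) * e (j - i))"
    by (rule sum.triangle_reindex_eq)
  also have "\<dots> = (\<Sum>j\<le>K. h j * (\<Sum>i\<le>j. b i * e (j - i)))"
    by (intro sum.cong refl) (simp add: sum_distrib_left mult_ac)
  also have "\<dots> = (\<Sum>j\<le>K. h j * fps_nth (todd_fps d w * exp_diff_fps d w) j)"
    by (simp add: fps_mult_nth b_def e_def atLeast0AtMost)
  also have "todd_fps d w * exp_diff_fps d w = fps_X ^ d"
    by (rule todd_fps_mult_exp_diff_fps) (use w_nonzero in auto)
  also have "(\<Sum>j\<le>K. h j * fps_nth (fps_X ^ d :: complex fps) j) = (\<Sum>j\<le>K. if j = d then h j else 0)"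
    by (intro sum.cong) (auto simp: fps_X_power_nth)
  also have "\<dots> = h d"
    by (simp add: K_def)
  finally show ?thesis
    by (simp add: b_def K_def)
qed

text \<open>Each \<open>hpow \<alpha> m\<close> is replaced by its Taylor polynomial at
  \<open>y\<close>. By \<open>fdiff_taylor_polynomial\<close> these polynomials reproduce
  \<open>hpow \<alpha> d y\<close> exactly, so only Taylor remainders are left. The degrees
  \<open>d + N - m\<close> are chosen so that all remainders involve the same derivative
  \<open>hpow \<alpha> (Suc (d + N))\<close>.\<close>

lemma R_norm_le:
  assumes y: "y \<in> hp"
    and B: "\<And>t. \<rho> y \<le> \<rho> t \<Longrightarrow> norm (hpow \<alpha> (Suc (d + N)) t) \<le> B"
  shows "norm (R N \<alpha> y) \<le> (\<Sum>S\<in>Pow {1..d}. \<Sum>m\<le>N. norm (b m) *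
            (norm (\<Sum>i\<in>S. w i) ^ Suc (d + N - m) / fact (d + N - m))) * B"
proof -
  define v where "v = (\<lambda>S. \<Sum>i\<in>S. w i)"
  define T where "T = (\<lambda>S m. \<Sum>k\<le>d+N-m. hpow \<alpha> (m + k) y * v S ^ k / fact k)"
  have T: "norm (hpow \<alpha> m (y + v S) - T S m) \<le> norm (v S) ^ Suc (d + N - m) / fact (d + N - m) * B"
    if S: "S \<subseteq> {1..d}" and m: "m \<le> N" for S m
  proof -
    \<comment> \<open>Moving along a sum of the \<open>w i\<close> never decreases \<rho>, so the
      bound \<open>B\<close> is available on the whole segment.\<close>
    have seg: "\<rho> y \<le> \<rho> t" if "t \<in> closed_segment y (y + v S)" for t
    proof -
      from that obtain u where u: "0 \<le> u" "t = (1 - u) *\<^sub>R y + u *\<^sub>R (y + v S)"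
        by (auto simp: in_segment)
      have "t = y + of_real u * v S"
        by (simp add: u scaleR_conv_of_real algebra_simps)
      thus ?thesis using u \<rho>_sum_w_nonneg[OF S] by (simp add: \<rho>_add \<rho>_scale v_def)
    qed
    have "norm (hpow \<alpha> (m + 0) (y + v S) - (\<Sum>i\<le>d+N-m. hpow \<alpha> (m + i) y * ((y + v S) - y) ^ i / fact i))
            \<le> B * norm ((y + v S) - y) ^ Suc (d+N-m) / fact (d+N-m)"
    proof (rule complex_Taylor[of "closed_segment y (y + v S)" "d+N-m" "\<lambda>i. hpow \<alpha> (m + i)"])
      fix i x assume "x \<in> closed_segment y (y + v S)"
      hence "x \<in> hp" using seg y by (fastforce simp: hp_iff)
      thus "(hpow \<alpha> (m + i) has_field_derivative hpow \<alpha> (m + Suc i) x) (at x within closed_segment y (y + v S))"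
        using DERIV_hpow has_field_derivative_at_within by fastforce
    next
      fix x assume "x \<in> closed_segment y (y + v S)"
      moreover have "m + Suc (d + N - m) = Suc (d + N)" using m by simp
      ultimately show "norm (hpow \<alpha> (m + Suc (d + N - m)) x) \<le> B"
        using B seg by metis
    qed auto
    thus ?thesis by (simp add: T_def mult_ac)
  qed
  have "R N \<alpha> y = (\<Sum>S\<in>Pow {1..d}. (-1) ^ (d - card S) * (\<Sum>m\<le>N. b m * T S m)) - fdiff d w (\<phi> N \<alpha>) y"
    using fdiff_taylor_polynomial[where N = N and h = "\<lambda>k. hpow \<alpha> k y"] by (simp add: R_def T_def v_def)
  also have "\<dots> = (\<Sum>S\<in>Pow {1..d}. (-1) ^ (d - card S) * (\<Sum>m\<le>N. b m * (T S m - hpow \<alpha> m (y + v S))))"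
    by (simp add: fdiff_def \<phi>_def v_def ring_distribs sum_subtractf)
  finally have R_eq: "R N \<alpha> y =
    (\<Sum>S\<in>Pow {1..d}. (-1) ^ (d - card S) * (\<Sum>m\<le>N. b m * (T S m - hpow \<alpha> m (y + v S))))" .
  have "norm (R N \<alpha> y) \<le>
    (\<Sum>S\<in>Pow {1..d}. \<Sum>m\<le>N. norm (b m) * (norm (v S) ^ Suc (d + N - m) / fact (d + N - m) * B))"
    unfolding R_eq
  proof (rule sum_norm_le)
    fix S assume S: "S \<in> Pow {1..d}"
    have "norm ((-1) ^ (d - card S) * (\<Sum>m\<le>N. b m * (T S m - hpow \<alpha> m (y + v S)))) =
          norm (\<Sum>m\<le>N. b m * (T S m - hpow \<alpha> m (y + v S)))"
      by (simp add: norm_mult norm_power)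
    also have "\<dots> \<le> (\<Sum>m\<le>N. norm (b m) * (norm (v S) ^ Suc (d + N - m) / fact (d + N - m) * B))"
    proof (rule sum_norm_le)
      fix m assume m: "m \<in> {..N}"
      show "norm (b m * (T S m - hpow \<alpha> m (y + v S))) \<le>
              norm (b m) * (norm (v S) ^ Suc (d + N - m) / fact (d + N - m) * B)"
        unfolding norm_mult norm_minus_commute[of "T S m"]
        by (rule mult_left_mono[OF T]) (use S m in auto)
    qed
    finally show "norm ((-1) ^ (d - card S) * (\<Sum>m\<le>N. b m * (T S m - hpow \<alpha> m (y + v S)))) \<le>
       (\<Sum>m\<le>N. norm (b m) * (norm (v S) ^ Suc (d + N - m) / fact (d + N - m) * B))" .
  qed
  thus ?thesis
    by (simp only: v_def sum_distrib_right mult.assoc)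
qed

text \<open>The derivative in the remainder has exponent \<open>- \<alpha> - (N + 1)\<close>, so
  \<open>power_bound\<close> applies with \<open>k = Suc N\<close>.\<close>

lemma R_bound:
  assumes a: "Re a > real d - real (Suc N)"
  obtains r M where "r > 0" "M summable_on nonzero_indices d"
    "\<And>\<alpha> n. \<alpha> \<in> cball a r \<Longrightarrow> n \<in> nonzero_indices d \<Longrightarrow> norm (R N \<alpha> (lincomb d n w)) \<le> M n"
proof -
  define C where "C = (\<Sum>S\<in>Pow {1..d}. \<Sum>m\<le>N. norm (b m) *
            (norm (\<Sum>i\<in>S. w i) ^ Suc (d + N - m) / fact (d + N - m)))"
  define p where "p = (\<lambda>\<alpha> :: complex. \<Prod>i<Suc (d + N). of_nat d - of_nat i - \<alpha>)"
  have "continuous_on UNIV p" unfolding p_def by (intro continuous_intros)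
  from power_bound[OF this a] obtain r M where rM: "r > 0" "M summable_on nonzero_indices d"
    "\<And>\<alpha> n t. \<alpha> \<in> cball a r \<Longrightarrow> n \<in> nonzero_indices d \<Longrightarrow> \<rho> (lincomb d n w) \<le> \<rho> t \<Longrightarrow>
       norm (p \<alpha> * exp ((- \<alpha> - of_nat (Suc N)) * lg t)) \<le> M n" by blast
  show ?thesis
  proof (rule that[of r "\<lambda>n. C * M n"])
    show "(\<lambda>n. C * M n) summable_on nonzero_indices d"
      by (intro summable_on_cmult_right rM)
    fix \<alpha> n assume *: "\<alpha> \<in> cball a r" "n \<in> nonzero_indices d"
    show "norm (R N \<alpha> (lincomb d n w)) \<le> C * M n"
      unfolding C_def
    proof (rule R_norm_le)
      fix t assume "\<rho> (lincomb d n w) \<le> \<rho> t"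
      from rM(3)[OF * this]
      have "norm (p \<alpha> * exp ((- \<alpha> - of_nat (Suc N)) * lg t)) \<le> M n" .
      moreover have "of_nat d - of_nat (Suc (d + N)) - \<alpha> = - \<alpha> - of_nat (Suc N)"
        by simp
      ultimately show "norm (hpow \<alpha> (Suc (d + N)) t) \<le> M n"
        unfolding hpow_def p_def by (simp only:)
    qed (use * lincomb_in_hp in auto)
  qed (use rM in auto)
qed

subsection \<open>Analytic continuation\<close>

text \<open>The product of \<open>j - \<alpha>\<close> for \<open>j\<close> from 1 to
  \<open>d\<close>, vanishing exactly at the candidate poles.\<close>

definition pole_factor :: "complex \<Rightarrow> complex" where
  "pole_factor \<alpha> = (\<Prod>i<d. of_nat d - of_nat i - \<alpha>)"

lemma hpow_d: "hpow \<alpha> d z = pole_factor \<alpha> * exp (-\<alpha> * lg z)"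
  by (simp add: hpow_def pole_factor_def)

lemma pole_factor_nonzero:
  assumes "Re \<alpha> > real d \<or> Re \<alpha> < 1"
  shows "pole_factor \<alpha> \<noteq> 0"
proof
  assume "pole_factor \<alpha> = 0"
  then obtain i where "i < d" "of_nat d - of_nat i - \<alpha> = 0"
    by (auto simp: pole_factor_def)
  hence "\<alpha> = of_nat (d - i)" by (simp add: of_nat_diff)
  hence "Re \<alpha> = real (d - i)" by simp
  with assms \<open>i < d\<close> show False by auto
qed

lemma holomorphic_R [holomorphic_intros]: "(\<lambda>\<alpha>. R N \<alpha> y) holomorphic_on A"
  unfolding R_def fdiff_def \<phi>_def hpow_def by (intro holomorphic_intros)

definition zeta_series :: "complex \<Rightarrow> complex" where
  "zeta_series \<alpha> = (\<Sum>\<^sub>\<infinity>n\<in>nonzero_indices d. exp (- \<alpha> * lg (lincomb d n w)))"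

text \<open>A continuation of \<open>pole_factor \<alpha> * zeta_series \<alpha>\<close>, obtained
  by replacing the telescoping part of the sum with its value.\<close>

definition E :: "nat \<Rightarrow> complex \<Rightarrow> complex" where
  "E N \<alpha> = (\<Sum>\<^sub>\<infinity>n\<in>nonzero_indices d. R N \<alpha> (lincomb d n w)) - F_op d (\<phi> N \<alpha>) w"

lemma holomorphic_E: "E N holomorphic_on {\<alpha>. Re \<alpha> > real d - real (Suc N)}"
proof -
  have "(\<lambda>\<alpha>. \<Sum>\<^sub>\<infinity>n\<in>nonzero_indices d. R N \<alpha> (lincomb d n w)) analytic_on {a}"
    if a: "Re a > real d - real (Suc N)" for a
  proof -
    obtain r M where rM: "r > 0" "M summable_on nonzero_indices d"
      "\<And>\<alpha> n. \<alpha> \<in> cball a r \<Longrightarrow> n \<in> nonzero_indices d \<Longrightarrow> norm (R N \<alpha> (lincomb d n w)) \<le> M n"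
      using R_bound[OF a] by blast
    have "(\<lambda>\<alpha>. \<Sum>\<^sub>\<infinity>n\<in>nonzero_indices d. R N \<alpha> (lincomb d n w)) holomorphic_on ball a r"
      by (rule infsum_holomorphic_deriv(1)[where R = "r + 1" and M = M])
         (use rM in \<open>auto intro!: holomorphic_intros\<close>)
    thus ?thesis using rM(1) by (auto simp: analytic_on_def)
  qed
  hence "(\<lambda>\<alpha>. \<Sum>\<^sub>\<infinity>n\<in>nonzero_indices d. R N \<alpha> (lincomb d n w)) analytic_on {\<alpha>. Re \<alpha> > real d - real (Suc N)}"
    by (subst analytic_on_analytic_at) auto
  hence "(\<lambda>\<alpha>. \<Sum>\<^sub>\<infinity>n\<in>nonzero_indices d. R N \<alpha> (lincomb d n w)) holomorphic_on {\<alpha>. Re \<alpha> > real d - real (Suc N)}"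
    by (rule analytic_imp_holomorphic)
  thus ?thesis
    unfolding E_def F_op_def \<phi>_def hpow_def by (intro holomorphic_intros)
qed

lemma exp_bound:
  assumes "Re a > real d"
  obtains r M where "r > 0" "M summable_on nonzero_indices d"
    "\<And>\<alpha> n. \<alpha> \<in> cball a r \<Longrightarrow> n \<in> nonzero_indices d \<Longrightarrow> norm (exp (- \<alpha> * lg (lincomb d n w))) \<le> M n"
proof -
  have a: "Re a > real d - real 0" using assms by simp
  show ?thesis
    by (rule power_bound[OF continuous_on_const[of _ 1] a]) (use that in auto)
qed

lemma summable_exp:
  assumes "Re a > real d"
  shows "(\<lambda>n. exp (- a * lg (lincomb d n w))) summable_on nonzero_indices d"
proof -
  obtain r M where rM: "r > 0" "M summable_on nonzero_indices d"
    "\<And>\<alpha> n. \<alpha> \<in> cball a r \<Longrightarrow> n \<in> nonzero_indices d \<Longrightarrow> norm (exp (- \<alpha> * lg (lincomb d n w))) \<le> M n"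
    using exp_bound[OF assms] by metis
  show ?thesis
    by (rule abs_summable_summable, rule Infinite_Sum.abs_summable_on_comparison_test'[OF rM(2)]) (use rM in auto)
qed

lemma holomorphic_zeta_series: "zeta_series holomorphic_on {\<alpha>. Re \<alpha> > real d}"
proof -
  have "zeta_series analytic_on {a}" if a: "Re a > real d" for a
  proof -
    obtain r M where rM: "r > 0" "M summable_on nonzero_indices d"
      "\<And>\<alpha> n. \<alpha> \<in> cball a r \<Longrightarrow> n \<in> nonzero_indices d \<Longrightarrow> norm (exp (- \<alpha> * lg (lincomb d n w))) \<le> M n"
      using exp_bound[OF a] by metis
    have "zeta_series holomorphic_on ball a r"
      unfolding zeta_series_def
      by (rule infsum_holomorphic_deriv(1)[where R = "r + 1" and M = M])
         (use rM in \<open>auto intro!: holomorphic_intros\<close>)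
    thus ?thesis using rM(1) by (auto simp: analytic_on_def)
  qed
  hence "zeta_series analytic_on {\<alpha>. Re \<alpha> > real d}"
    by (subst analytic_on_analytic_at) auto
  thus ?thesis by (rule analytic_imp_holomorphic)
qed

text \<open>The slowest decay is at \<open>m = 0\<close>, with exponent \<open>d - \<alpha>\<close>;
  this is why the real part has to exceed \<open>2 * d\<close>.\<close>

lemma summable_hpow:
  assumes "Re \<alpha> > 2 * real d"
  shows "(\<lambda>n. hpow \<alpha> m (lincomb d n w)) summable_on nonzero_indices d"
proof -
  have "Re (\<alpha> + of_nat m - of_nat d) > real d" using assms by simp
  from summable_on_cmult_right[OF summable_exp[OF this], of "\<Prod>i<m. of_nat d - of_nat i - \<alpha>"]
  show ?thesis by (simp add: hpow_def algebra_simps)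
qed

text \<open>In this region \<open>\<phi> N \<alpha>\<close> itself is summable over the lattice, so
  the differences telescope and cancel the \<open>F_op\<close> term of \<open>E\<close>.\<close>

lemma E_eq_aux:
  assumes "Re \<alpha> > 2 * real d"
  shows "E N \<alpha> = pole_factor \<alpha> * zeta_series \<alpha>"
proof -
  have "((\<lambda>n. fdiff d w (\<phi> N \<alpha>) (lincomb d n w)) has_sum - F_op d (\<phi> N \<alpha>) w) (nonzero_indices d)"
  proof (rule has_sum_fdiff_telescope)
    show "(\<lambda>n. \<phi> N \<alpha> (lincomb d n w)) summable_on nonzero_indices d"
      unfolding \<phi>_def by (intro summable_on_sum summable_on_cmult_right summable_hpow assms)
  qed (use lincomb_in_hp sum_w_in_hp hp_nonzero in auto)
  moreover have "((\<lambda>n. hpow \<alpha> d (lincomb d n w)) has_sum (pole_factor \<alpha> * zeta_series \<alpha>)) (nonzero_indices d)"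
    unfolding hpow_d zeta_series_def
    by (intro has_sum_cmult_right has_sum_infsum summable_exp) (use assms in auto)
  ultimately have "((\<lambda>n. R N \<alpha> (lincomb d n w)) has_sum (pole_factor \<alpha> * zeta_series \<alpha> - (- F_op d (\<phi> N \<alpha>) w))) (nonzero_indices d)"
    unfolding R_def diff_conv_add_uminus by (intro has_sum_add has_sum_uminusI)
  from infsumI[OF this] show ?thesis by (simp add: E_def)
qed

section \<open>Gluing the continuations by the identity theorem\<close>

lemma connected_Re_gt: "connected {z. Re z > c}"
  by (intro convex_connected convex_halfspace_Re_gt)

lemma E_eq:
  assumes "Re \<alpha> > real d"
  shows "E N \<alpha> = pole_factor \<alpha> * zeta_series \<alpha>"
proof (rule analytic_continuation_open[of "{\<alpha>. Re \<alpha> > 2 * real d}" "{\<alpha>. Re \<alpha> > real d}" "E N"])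
  show "{\<alpha>. Re \<alpha> > 2 * real d} \<noteq> {}"
    by (auto intro!: exI[of _ "complex_of_real (2 * real d + 1)"])
  show "E N holomorphic_on {\<alpha>. Re \<alpha> > real d}"
    by (rule holomorphic_on_subset[OF holomorphic_E]) auto
  show "(\<lambda>\<alpha>. pole_factor \<alpha> * zeta_series \<alpha>) holomorphic_on {\<alpha>. Re \<alpha> > real d}"
    unfolding pole_factor_def by (intro holomorphic_intros holomorphic_zeta_series)
qed (use assms E_eq_aux in \<open>auto intro: open_halfspace_Re_gt connected_Re_gt\<close>)

lemma E_consistent:
  assumes "Re \<alpha> > real d - real (Suc N)" "N \<le> N'"
  shows "E N \<alpha> = E N' \<alpha>"
proof (rule analytic_continuation_open[of "{\<alpha>. Re \<alpha> > real d}" "{\<alpha>. Re \<alpha> > real d - real (Suc N)}" "E N"])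
  show "{\<alpha>. Re \<alpha> > real d} \<noteq> {}"
    by (auto intro!: exI[of _ "complex_of_real (real d + 1)"])
  show "E N holomorphic_on {\<alpha>. Re \<alpha> > real d - real (Suc N)}"
    by (rule holomorphic_E)
  show "E N' holomorphic_on {\<alpha>. Re \<alpha> > real d - real (Suc N)}"
    by (rule holomorphic_on_subset[OF holomorphic_E]) (use assms in auto)
qed (use assms E_eq in \<open>auto intro: open_halfspace_Re_gt connected_Re_gt\<close>)

text \<open>The truncation order varies with \<alpha> so that \<alpha> always lies in the half-plane
  of validity; by \<open>E_consistent\<close> the pieces agree.\<close>

definition entire_zeta :: "complex \<Rightarrow> complex" where
  "entire_zeta \<alpha> = E (nat \<lceil>real d - Re \<alpha>\<rceil>) \<alpha>"

lemma entire_zeta_eq: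
  assumes "Re \<alpha> > real d - real (Suc N)"
  shows "entire_zeta \<alpha> = E N \<alpha>"
proof -
  define N' where "N' = nat \<lceil>real d - Re \<alpha>\<rceil>"
  have "real N' \<ge> real d - Re \<alpha>" unfolding N'_def by linarith
  hence N': "Re \<alpha> > real d - real (Suc N')" by simp
  show ?thesis
    unfolding entire_zeta_def N'_def[symmetric]
    using E_consistent[OF N', of N] E_consistent[OF assms, of N'] by (metis nle_le)
qed

lemma holomorphic_entire_zeta: "entire_zeta holomorphic_on UNIV"
proof -
  have "entire_zeta analytic_on {a}" for a
  proof -
    define N where "N = nat \<lceil>real d - Re a\<rceil>"
    have "real N \<ge> real d - Re a" unfolding N_def by linarith
    hence N: "Re a > real d - real (Suc N)" by simp
    have "entire_zeta holomorphic_on {\<alpha>. Re \<alpha> > real d - real (Suc N)}"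
      by (rule holomorphic_transform[OF holomorphic_E[of N]]) (simp add: entire_zeta_eq)
    thus ?thesis
      using N open_halfspace_Re_gt[of "real d - real (Suc N)"] unfolding analytic_at
      by (intro exI[of _ "{\<alpha>. Re \<alpha> > real d - real (Suc N)}"]) auto
  qed
  hence "entire_zeta analytic_on UNIV"
    by (subst analytic_on_analytic_at) auto
  thus ?thesis by (rule analytic_imp_holomorphic)
qed

text \<open>The difference vanishes on an open set, so it cannot avoid 0 off a sparse set and must
  vanish off one. Hence both functions have the same limits and poles, and the values follow by
  continuity or by the convention of 0 at poles.\<close>

lemma nicely_meromorphic_on_UNIV_unique:
  assumes "Z nicely_meromorphic_on UNIV" "Z' nicely_meromorphic_on UNIV"
    and "open U" "U \<noteq> {}" "\<And>z. z \<in> U \<Longrightarrow> Z z = Z' z"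
  shows "Z = Z'"
proof -
  have mero: "(\<lambda>z. Z z - Z' z) meromorphic_on UNIV"
    using assms(1,2) by (intro meromorphic_intros) (auto simp: nicely_meromorphic_on_def)
  have "\<not> eventually (\<lambda>z. Z z - Z' z \<noteq> 0) (cosparse UNIV)"
  proof
    assume *: "eventually (\<lambda>z. Z z - Z' z \<noteq> 0) (cosparse UNIV)"
    obtain z0 where z0: "z0 \<in> U" using assms(4) by blast
    have "eventually (\<lambda>z. Z z - Z' z \<noteq> 0) (at z0)"
      using * by (auto simp: eventually_cosparse_open_eq)
    moreover have "eventually (\<lambda>z. z \<in> U) (at z0)"
      by (rule eventually_at_in_open'[OF assms(3) z0])
    ultimately have "eventually (\<lambda>z. False) (at z0)"
      by eventually_elim (use assms(5) in auto)
    thus False by simp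
  qed
  hence "eventually (\<lambda>z. Z z - Z' z = 0) (cosparse UNIV)"
    using meromorphic_imp_constant_or_avoid[OF mero open_UNIV connected_UNIV] by blast
  hence ev: "eventually (\<lambda>z. Z z = Z' z) (at x)" for x
    by (auto simp: eventually_cosparse_open_eq)
  have no_pole: "\<not> is_pole f x" if "f \<midarrow>x\<rightarrow> f x" for f :: "complex \<Rightarrow> complex" and x
    using that not_tendsto_and_filterlim_at_infinity[of "at x" f] by (auto simp: is_pole_def)
  show ?thesis
  proof
    fix x
    have pole: "is_pole Z x \<longleftrightarrow> is_pole Z' x"
      by (rule is_pole_cong[OF ev refl])
    have "is_pole Z x \<and> Z x = 0 \<or> Z \<midarrow>x\<rightarrow> Z x" "is_pole Z' x \<and> Z' x = 0 \<or> Z' \<midarrow>x\<rightarrow> Z' x"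
      using assms(1,2) by (auto simp: nicely_meromorphic_on_def)
    then consider "Z x = 0" "Z' x = 0" | "Z \<midarrow>x\<rightarrow> Z x" "Z' \<midarrow>x\<rightarrow> Z' x"
      using no_pole pole by blast
    thus "Z x = Z' x"
    proof cases
      case 2
      from 2(1) have "Z' \<midarrow>x\<rightarrow> Z x"
        by (rule Lim_transform_eventually) (rule ev)
      with 2(2) show ?thesis using LIM_unique by blast
    qed auto
  qed
qed

text \<open>\<open>remove_sings\<close> fills removable singularities and puts 0 at poles, which is
  the normalisation demanded by \<open>nicely_meromorphic_on\<close>.\<close>

lemma barnes_zeta_eq:
  "barnes_zeta lg d w = remove_sings (\<lambda>\<alpha>. entire_zeta \<alpha> / pole_factor \<alpha>)"
proof -
  let ?Z = "remove_sings (\<lambda>\<alpha>. entire_zeta \<alpha> / pole_factor \<alpha>)"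
  have "entire_zeta analytic_on UNIV" "pole_factor analytic_on UNIV"
    using holomorphic_entire_zeta by (auto simp: analytic_on_open pole_factor_def[abs_def] intro!: holomorphic_intros)
  hence an: "entire_zeta meromorphic_on UNIV" "pole_factor meromorphic_on UNIV"
    by (auto intro: analytic_on_imp_meromorphic_on)
  hence nice: "?Z nicely_meromorphic_on UNIV"
    by (intro remove_sings_nicely_meromorphic meromorphic_intros)
  have eq: "?Z \<alpha> = zeta_series \<alpha>" if \<alpha>: "Re \<alpha> > real d" for \<alpha>
  proof -
    have "?Z \<alpha> = entire_zeta \<alpha> / pole_factor \<alpha>"
    proof (rule remove_sings_at_analytic)
      have "(\<lambda>\<alpha>. entire_zeta \<alpha> / pole_factor \<alpha>) holomorphic_on {\<alpha>. Re \<alpha> > real d}"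
        using pole_factor_nonzero unfolding pole_factor_def
        by (intro holomorphic_intros holomorphic_on_subset[OF holomorphic_entire_zeta]) auto
      thus "(\<lambda>\<alpha>. entire_zeta \<alpha> / pole_factor \<alpha>) analytic_on {\<alpha>}"
        using \<alpha> open_halfspace_Re_gt analytic_at by blast
    qed
    also have "entire_zeta \<alpha> = E 0 \<alpha>"
      by (rule entire_zeta_eq) (use \<alpha> in auto)
    also have "\<dots> / pole_factor \<alpha> = zeta_series \<alpha>"
      using pole_factor_nonzero[of \<alpha>] \<alpha> by (subst E_eq) auto
    finally show ?thesis .
  qed
  show ?thesis
    unfolding barnes_zeta_def zeta_series_def[symmetric]
  proof (rule the_equality)
    fix Z assume Z: "Z nicely_meromorphic_on UNIV \<and> (\<forall>\<alpha>. real d < Re \<alpha> \<longrightarrow> Z \<alpha> = zeta_series \<alpha>)"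
    show "Z = ?Z"
    proof (rule nicely_meromorphic_on_UNIV_unique)
      show "{\<alpha>. Re \<alpha> > real d} \<noteq> {}"
        by (auto intro!: exI[of _ "complex_of_real (real d + 1)"])
    qed (use Z nice eq open_halfspace_Re_gt in auto)
  qed (use nice eq in auto)
qed

subsection \<open>The derivative at zero\<close>

text \<open>For \<open>k = d - m\<close> this inverts the factors of \<open>pole_factor\<close> that
  the prefactor of \<open>hpow \<alpha> m\<close> leaves uncancelled.\<close>

definition q :: "nat \<Rightarrow> complex \<Rightarrow> complex" where "q k \<alpha> = (\<Prod>i<k. inverse (of_nat (Suc i) - \<alpha>))"

text \<open>The logarithmic derivative at 0 is the sum of the \<open>1 / (i + 1)\<close> for
  \<open>i < k\<close>; all harmonic numbers in the formula come from here.\<close>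

lemma DERIV_q_0: "(q k has_field_derivative harm k / fact k) (at 0)"
  and q_0: "q k 0 = 1 / fact k"
proof -
  show q0: "q k 0 = 1 / fact k" for k
  proof (induction k)
    case (Suc k)
    have "q (Suc k) 0 = q k 0 * inverse (of_nat (Suc k))"
      by (simp add: q_def)
    also have "\<dots> = 1 / fact (Suc k)"
      unfolding Suc by (simp add: fact_Suc divide_inverse del: of_nat_Suc)
    finally show ?case .
  qed (simp add: q_def)
  show "(q k has_field_derivative harm k / fact k) (at 0)"
  proof (induction k)
    case 0
    thus ?case by (simp add: q_def[abs_def] harm_def)
  next
    case (Suc k)
    have "((\<lambda>\<alpha>. q k \<alpha> * inverse (of_nat (Suc k) - \<alpha>)) has_field_derivative
             (harm k / fact k * inverse (of_nat (Suc k)) + q k 0 * (1 / of_nat (Suc k) ^ 2))) (at 0)"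
      by (auto intro!: derivative_eq_intros Suc simp del: of_nat_Suc simp: power2_eq_square field_simps)
    moreover have "harm k / fact k * inverse (of_nat (Suc k)) + q k 0 * (1 / of_nat (Suc k) ^ 2) =
                   (harm (Suc k) / fact (Suc k) :: complex)"
      unfolding q0 by (simp add: harm_Suc fact_Suc field_simps power2_eq_square del: of_nat_Suc)
    ultimately show ?case
      by (simp add: q_def[abs_def] mult.commute)
  qed
qed

lemma hpow_div_pole_factor:
  assumes "Re \<alpha> < 1" "m \<le> d" "z \<in> hp"
  shows "hpow \<alpha> m z / pole_factor \<alpha> = q (d - m) \<alpha> * (z ^ (d - m) * exp (-\<alpha> * lg z))"
proof -
  have nz: "of_nat d - of_nat i - \<alpha> \<noteq> 0" if "i < d" for i
    using pole_factor_nonzero[of \<alpha>] assms that by (auto simp: pole_factor_def)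
  have "exp ((of_nat d - of_nat m - \<alpha>) * lg z) = exp (of_nat (d - m) * lg z + (-\<alpha> * lg z))"
    using assms by (simp add: of_nat_diff algebra_simps)
  also have "\<dots> = z ^ (d - m) * exp (-\<alpha> * lg z)"
    using exp_lg[OF assms(3)] by (simp only: exp_add exp_of_nat_mult)
  finally have *: "exp ((of_nat d - of_nat m - \<alpha>) * lg z) = z ^ (d - m) * exp (-\<alpha> * lg z)" .
  have "q (d - m) \<alpha> = (\<Prod>i\<in>{m..<d}. inverse (of_nat d - of_nat i - \<alpha>))"
    unfolding q_def
    \<comment> \<open>Reversal of the order: \<open>d - i\<close> for \<open>i\<close> from
      \<open>m\<close> to \<open>d - 1\<close> runs through \<open>d - m\<close> down to 1.\<close>
    by (rule prod.reindex_bij_witness[of _ "\<lambda>i. d - 1 - i" "\<lambda>i. d - 1 - i"])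
       (use assms in \<open>auto simp: of_nat_diff\<close>)
  also have "\<dots> = inverse (\<Prod>i\<in>{m..<d}. of_nat d - of_nat i - \<alpha>)"
    by (simp add: prod_inversef[symmetric] o_def)
  finally have "q (d - m) \<alpha> * (\<Prod>i\<in>{m..<d}. of_nat d - of_nat i - \<alpha>) = 1"
    using nz by (simp add: field_simps)
  moreover have "pole_factor \<alpha> = (\<Prod>i<m. of_nat d - of_nat i - \<alpha>) * (\<Prod>i\<in>{m..<d}. of_nat d - of_nat i - \<alpha>)"
    unfolding pole_factor_def using assms
    by (subst prod.union_disjoint[symmetric]) (auto intro!: prod.cong)
  moreover have "pole_factor \<alpha> \<noteq> 0"
    using pole_factor_nonzero[of \<alpha>] assms by auto
  ultimately have "(\<Prod>i<m. of_nat d - of_nat i - \<alpha>) / pole_factor \<alpha> = q (d - m) \<alpha>"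
    by (simp add: divide_simps mult_ac)
  thus ?thesis by (simp add: hpow_def * flip: times_divide_eq_left)
qed

lemma \<phi>_div_pole_factor:
  assumes "Re \<alpha> < 1" "z \<in> hp"
  shows "\<phi> d \<alpha> z / pole_factor \<alpha> = (\<Sum>m\<le>d. b m * (q (d - m) \<alpha> * (z ^ (d - m) * exp (-\<alpha> * lg z))))"
  using hpow_div_pole_factor[OF assms(1) _ assms(2)]
  by (simp add: \<phi>_def b_def sum_divide_distrib flip: times_divide_eq_right)

text \<open>In the product rule, differentiating \<open>q\<close> gives the harmonic number and
  differentiating the exponential gives \<open>- lg z\<close>.\<close>

lemma DERIV_\<phi>_div_pole_factor:
  assumes z: "z \<in> hp"
  shows "((\<lambda>\<alpha>. \<phi> d \<alpha> z / pole_factor \<alpha>) has_field_derivative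
           (\<Sum>m\<le>d. b m / fact (d - m) * (harm (d - m) * z ^ (d - m) - z ^ (d - m) * lg z))) (at 0)"
proof -
  have "((\<lambda>\<alpha>. \<Sum>m\<le>d. b m * (q (d - m) \<alpha> * (z ^ (d - m) * exp (-\<alpha> * lg z)))) has_field_derivative
           (\<Sum>m\<le>d. b m / fact (d - m) * (harm (d - m) * z ^ (d - m) - z ^ (d - m) * lg z))) (at 0)"
    by (auto intro!: derivative_eq_intros DERIV_q_0 sum.cong simp: q_0 field_simps)
  thus ?thesis
  proof (rule has_field_derivative_transform_within_open)
    show "open {\<alpha>. Re \<alpha> < 1}" by (rule open_halfspace_Re_lt)
  qed (use \<phi>_div_pole_factor z in auto)
qed

text \<open>Only the leading term \<open>m = 0\<close> survives, as the operator annihilates polynomials of degree less than \<open>d\<close>.\<close>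
lemma sum_harm_fdiff:
  "(\<Sum>m\<le>d. b m / fact (d - m) * (harm (d - m) * fdiff d w (\<lambda>x. x ^ (d - m)) y)) = harm d"
proof -
  have "(\<Sum>m\<le>d. b m / fact (d - m) * (harm (d - m) * fdiff d w (\<lambda>x. x ^ (d - m)) y)) =
        (\<Sum>m\<le>d. if m = 0 then b 0 / fact d * (harm d * fdiff d w (\<lambda>x. x ^ d) y) else 0)"
    by (intro sum.cong) (auto simp: fdiff_power_less)
  also have "\<dots> = b 0 * harm d * (\<Prod>i=1..d. w i)"
    by (simp add: fdiff_power_eq)
  also have "\<dots> = harm d"
    using w_nonzero by (simp add: b_def todd_fps_nth_0)
  finally show ?thesis .
qed

section \<open>Termwise differentiation at zero\<close>

lemma fdiff_sum: "fdiff d w (\<lambda>x. \<Sum>m\<in>A. f m x) y = (\<Sum>m\<in>A. fdiff d w (f m) y)"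
  unfolding fdiff_def sum_distrib_left by (rule sum.swap)

lemma fdiff_cmult: "fdiff d w (\<lambda>x. c * f x) y = c * fdiff d w f y"
  by (simp add: fdiff_def sum_distrib_left mult_ac)

lemma fdiff_diff: "fdiff d w (\<lambda>x. f x - g x) y = fdiff d w f y - fdiff d w g y"
  by (simp add: fdiff_def ring_distribs sum_subtractf)

lemma DERIV_R_div_pole_factor:
  assumes y: "y \<in> hp"
  shows "((\<lambda>\<alpha>. R d \<alpha> y / pole_factor \<alpha>) has_field_derivative
           (- lg y - harm d + (\<Sum>m\<le>d. b m / fact (d - m) * fdiff d w (\<lambda>x. x ^ (d - m) * lg x) y))) (at 0)"
proof -
  have "((\<lambda>\<alpha>. exp (-\<alpha> * lg y) - fdiff d w (\<lambda>z. \<phi> d \<alpha> z / pole_factor \<alpha>) y) has_field_derivative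
          (- lg y - fdiff d w (\<lambda>z. \<Sum>m\<le>d. b m / fact (d - m) * (harm (d - m) * z ^ (d - m) - z ^ (d - m) * lg z)) y)) (at 0)"
  proof (rule DERIV_diff)
    show "((\<lambda>\<alpha>. exp (-\<alpha> * lg y)) has_field_derivative - lg y) (at 0)"
      by (auto intro!: derivative_eq_intros)
  qed (unfold fdiff_def, intro DERIV_sum DERIV_cmult DERIV_\<phi>_div_pole_factor add_sum_w_in_hp y, auto)
  also have "fdiff d w (\<lambda>z. \<Sum>m\<le>d. b m / fact (d - m) * (harm (d - m) * z ^ (d - m) - z ^ (d - m) * lg z)) y =
               harm d - (\<Sum>m\<le>d. b m / fact (d - m) * fdiff d w (\<lambda>x. x ^ (d - m) * lg x) y)"
    unfolding fdiff_sum fdiff_cmult fdiff_diff right_diff_distrib sum_subtractf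
    by (simp only: sum_harm_fdiff)
  finally have *: "((\<lambda>\<alpha>. exp (-\<alpha> * lg y) - fdiff d w (\<lambda>z. \<phi> d \<alpha> z / pole_factor \<alpha>) y) has_field_derivative
          (- lg y - (harm d - (\<Sum>m\<le>d. b m / fact (d - m) * fdiff d w (\<lambda>x. x ^ (d - m) * lg x) y)))) (at 0)" .
  have "((\<lambda>\<alpha>. R d \<alpha> y / pole_factor \<alpha>) has_field_derivative
          (- lg y - (harm d - (\<Sum>m\<le>d. b m / fact (d - m) * fdiff d w (\<lambda>x. x ^ (d - m) * lg x) y)))) (at 0)"
  proof (rule has_field_derivative_transform_within_open[OF *])
    show "open {\<alpha>. Re \<alpha> < 1}" by (rule open_halfspace_Re_lt)
    fix \<alpha> assume "\<alpha> \<in> {\<alpha>. Re \<alpha> < 1}"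
    hence "pole_factor \<alpha> \<noteq> 0" using pole_factor_nonzero by auto
    moreover have "fdiff d w (\<lambda>z. \<phi> d \<alpha> z / pole_factor \<alpha>) y = fdiff d w (\<phi> d \<alpha>) y / pole_factor \<alpha>"
      by (simp add: fdiff_def sum_divide_distrib)
    ultimately show "exp (-\<alpha> * lg y) - fdiff d w (\<lambda>z. \<phi> d \<alpha> z / pole_factor \<alpha>) y = R d \<alpha> y / pole_factor \<alpha>"
      by (simp add: R_def hpow_d diff_divide_distrib)
  qed auto
  thus ?thesis by (simp add: algebra_simps)
qed

lemma DERIV_F_div_pole_factor:
  "((\<lambda>\<alpha>. F_op d (\<phi> d \<alpha>) w / pole_factor \<alpha>) has_field_derivative
      (harm d - (\<Sum>m\<le>d. b m / fact (d - m) * F_op d (\<lambda>x. x ^ (d - m) * lg x) w))) (at 0)"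
proof -
  have "((\<lambda>\<alpha>. F_op d (\<lambda>z. \<phi> d \<alpha> z / pole_factor \<alpha>) w) has_field_derivative
          F_op d (\<lambda>z. \<Sum>m\<le>d. b m / fact (d - m) * (harm (d - m) * z ^ (d - m) - z ^ (d - m) * lg z)) w) (at 0)"
    unfolding F_op_def
    by (intro DERIV_sum DERIV_cmult DERIV_\<phi>_div_pole_factor sum_w_in_hp) auto
  moreover have "F_op d (\<lambda>z. \<phi> d \<alpha> z / pole_factor \<alpha>) w = F_op d (\<phi> d \<alpha>) w / pole_factor \<alpha>" for \<alpha>
    by (simp add: F_op_def sum_divide_distrib)
  moreover have "F_op d (\<lambda>z. \<Sum>m\<le>d. b m / fact (d - m) * (harm (d - m) * z ^ (d - m) - z ^ (d - m) * lg z)) w =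
      (\<Sum>m\<le>d. b m / fact (d - m) * (harm (d - m) * F_op d (\<lambda>x. x ^ (d - m)) w)) -
      (\<Sum>m\<le>d. b m / fact (d - m) * F_op d (\<lambda>x. x ^ (d - m) * lg x) w)"
  proof -
    have "F_op d (\<lambda>z. \<Sum>m\<le>d. g m z) w = (\<Sum>m\<le>d. F_op d (g m) w)" for g
      unfolding F_op_def sum_distrib_left by (rule sum.swap)
    moreover have "F_op d (\<lambda>z. c * g z) w = c * F_op d g w" for c g
      by (simp add: F_op_def sum_distrib_left mult_ac)
    moreover have "F_op d (\<lambda>z. g z - h z) w = F_op d g w - F_op d h w" for g h
      by (simp add: F_op_def ring_distribs sum_subtractf)
    ultimately show ?thesis
      by (simp only: right_diff_distrib sum_subtractf)
  qed
  moreover have "(\<Sum>m\<le>d. b m / fact (d - m) * (harm (d - m) * F_op d (\<lambda>x. x ^ (d - m)) w)) = harm d"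
  proof -
    \<comment> \<open>\<open>F_op\<close> omits the empty set, which would contribute a multiple of
      \<open>0 ^ (d - m)\<close>. This is nonzero only if \<open>d - m = 0\<close>, and then
      \<open>harm 0 = 0\<close> removes it.\<close>
    have "harm (d - m) * F_op d (\<lambda>x. x ^ (d - m)) w = harm (d - m) * fdiff d w (\<lambda>x. x ^ (d - m)) 0" for m
      by (cases "d - m = 0") (simp_all add: fdiff_0 harm_def)
    thus ?thesis by (simp only: sum_harm_fdiff)
  qed
  ultimately show ?thesis by simp
qed

text \<open>Truncation at \<open>N = d\<close> puts 0 inside the region of summable errors. Near 0
  the zeta function is \<open>E d \<alpha> / pole_factor \<alpha>\<close>, whose series can be
  differentiated termwise.\<close>

lemma DERIV_barnes_zeta:
  defines "T \<equiv> \<lambda>n. - lg (lincomb d n w) - harm d +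
             (\<Sum>m\<le>d. b m / fact (d - m) * fdiff d w (\<lambda>x. x ^ (d - m) * lg x) (lincomb d n w))"
  shows "(\<lambda>n. norm (T n)) summable_on nonzero_indices d"
    and "(barnes_zeta lg d w has_field_derivative
           (\<Sum>\<^sub>\<infinity>n\<in>nonzero_indices d. T n) +
           (\<Sum>m\<le>d. b m / fact (d - m) * F_op d (\<lambda>x. x ^ (d - m) * lg x) w) - harm d) (at 0)"
proof -
  have "Re 0 > real d - real (Suc d)" by simp
  from R_bound[OF this] obtain r M where rM: "r > 0" "M summable_on nonzero_indices d"
    "\<And>\<alpha> n. \<alpha> \<in> cball 0 r \<Longrightarrow> n \<in> nonzero_indices d \<Longrightarrow> norm (R d \<alpha> (lincomb d n w)) \<le> M n"
    by blast
  \<comment> \<open>A radius below 1 keeps the disc away from the zeros of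
    \<open>pole_factor\<close>, the nearest of which is 1.\<close>
  define r' where "r' = min r (1 / 2)"
  have r': "0 < r'" "r' \<le> r" "r' < 1" using rM(1) by (auto simp: r'_def)
  have Re1: "Re \<alpha> < 1" if "norm \<alpha> < 1" for \<alpha>
    using that complex_Re_le_cmod[of \<alpha>] by linarith
  have pf_hol: "pole_factor holomorphic_on A" for A
    unfolding pole_factor_def[abs_def] by (intro holomorphic_intros)
  have pf_nz: "pole_factor \<alpha> \<noteq> 0" if "norm \<alpha> < 1" for \<alpha>
    using pole_factor_nonzero Re1[OF that] by blast
  have "continuous_on (cball 0 r') (\<lambda>\<alpha>. inverse (pole_factor \<alpha>))"
    by (intro holomorphic_on_imp_continuous_on holomorphic_intros pf_hol pf_nz) (use r' in auto)
  hence "compact ((\<lambda>\<alpha>. inverse (pole_factor \<alpha>)) ` cball 0 r')"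
    by (intro compact_continuous_image) auto
  then obtain B where B: "\<And>\<alpha>. \<alpha> \<in> cball 0 r' \<Longrightarrow> norm (inverse (pole_factor \<alpha>)) \<le> B"
    using compact_imp_bounded bounded_iff by (metis imageI)
  define f where "f = (\<lambda>n \<alpha>. R d \<alpha> (lincomb d n w) / pole_factor \<alpha>)"
  have hol: "f n holomorphic_on ball 0 1" for n
    unfolding f_def using pf_nz by (intro holomorphic_intros pf_hol) auto
  have bound: "norm (f n \<alpha>) \<le> M n * B" if "n \<in> nonzero_indices d" "\<alpha> \<in> cball 0 r'" for n \<alpha>
  proof -
    have "norm (f n \<alpha>) = norm (R d \<alpha> (lincomb d n w)) * norm (inverse (pole_factor \<alpha>))"
      by (simp add: f_def norm_divide norm_inverse field_simps)
    also have "\<dots> \<le> M n * B"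
    proof (rule mult_mono)
      show "norm (R d \<alpha> (lincomb d n w)) \<le> M n" using that r' by (intro rM) auto
      thus "0 \<le> M n" by (rule order_trans[OF norm_ge_zero])
    qed (use B that in auto)
    finally show ?thesis .
  qed
  have MB: "(\<lambda>n. M n * B) summable_on nonzero_indices d"
    by (intro summable_on_cmult_left rM)
  note deriv = infsum_holomorphic_deriv[OF r'(1,3) hol bound MB]
  have df: "deriv (f n) 0 = T n" if "n \<in> nonzero_indices d" for n
    unfolding f_def T_def by (intro DERIV_imp_deriv DERIV_R_div_pole_factor lincomb_in_hp that)
  show "(\<lambda>n. norm (T n)) summable_on nonzero_indices d"
    using deriv(2) df by (simp cong: summable_on_cong)
  have "((\<lambda>\<alpha>. \<Sum>\<^sub>\<infinity>n\<in>nonzero_indices d. f n \<alpha>) has_field_derivative (\<Sum>\<^sub>\<infinity>n\<in>nonzero_indices d. T n)) (at 0)"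
    using deriv(3) df by (simp cong: infsum_cong)
  from DERIV_diff[OF this DERIV_F_div_pole_factor]
  have "((\<lambda>\<alpha>. (\<Sum>\<^sub>\<infinity>n\<in>nonzero_indices d. f n \<alpha>) - F_op d (\<phi> d \<alpha>) w / pole_factor \<alpha>) has_field_derivative
           (\<Sum>\<^sub>\<infinity>n\<in>nonzero_indices d. T n) +
           (\<Sum>m\<le>d. b m / fact (d - m) * F_op d (\<lambda>x. x ^ (d - m) * lg x) w) - harm d) (at 0)"
    by (simp add: algebra_simps)
  thus "(barnes_zeta lg d w has_field_derivative
           (\<Sum>\<^sub>\<infinity>n\<in>nonzero_indices d. T n) +
           (\<Sum>m\<le>d. b m / fact (d - m) * F_op d (\<lambda>x. x ^ (d - m) * lg x) w) - harm d) (at 0)"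
  proof (rule has_field_derivative_transform_within_open)
    fix \<alpha> :: complex assume \<alpha>: "\<alpha> \<in> ball 0 1"
    have "(\<lambda>\<alpha>. entire_zeta \<alpha> / pole_factor \<alpha>) holomorphic_on ball 0 1"
      using pf_nz by (intro holomorphic_intros pf_hol holomorphic_on_subset[OF holomorphic_entire_zeta]) auto
    hence "(\<lambda>\<alpha>. entire_zeta \<alpha> / pole_factor \<alpha>) analytic_on {\<alpha>}"
      using \<alpha> analytic_at open_ball by blast
    hence "barnes_zeta lg d w \<alpha> = entire_zeta \<alpha> / pole_factor \<alpha>"
      unfolding barnes_zeta_eq by (rule remove_sings_at_analytic)
    also have "entire_zeta \<alpha> = E d \<alpha>"
      by (rule entire_zeta_eq) (use \<alpha> abs_Re_le_cmod[of \<alpha>] in auto)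
    also have "\<dots> / pole_factor \<alpha> = (\<Sum>\<^sub>\<infinity>n\<in>nonzero_indices d. f n \<alpha>) - F_op d (\<phi> d \<alpha>) w / pole_factor \<alpha>"
      unfolding E_def f_def by (simp only: divide_inverse infsum_cmult_left' left_diff_distrib)
    finally show "(\<Sum>\<^sub>\<infinity>n\<in>nonzero_indices d. f n \<alpha>) - F_op d (\<phi> d \<alpha>) w / pole_factor \<alpha> = barnes_zeta lg d w \<alpha>" ..
  qed auto
qed

end

theorem mainTheorem7:
  fixes d :: nat and \<theta> :: real and lg :: "complex \<Rightarrow> complex" and w :: "nat \<Rightarrow> complex"
  assumes "d \<ge> 1"
    and "log_branch \<theta> lg"
    and "\<And>i. i \<in> {1..d} \<Longrightarrow> w i \<in> half_plane \<theta>"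
  shows
    "let c = (\<lambda>m. poly ((pderiv ^^ d) (bernoullian d w m)) 0 / (fact m * fact (d - m)));
         T = (\<lambda>n. - lg (lincomb d n w) - harm d
                + (\<Sum>m=0..d. c m * G_op d (\<lambda>x. (lincomb d n w + x) ^ (d - m) * lg (lincomb d n w + x)) w))
     in (\<lambda>n. norm (T n)) summable_on nonzero_indices d \<and>
        (barnes_zeta lg d w has_field_derivative
           ((\<Sum>\<^sub>\<infinity>n\<in>nonzero_indices d. T n)
            + (\<Sum>m=0..d. c m * F_op d (\<lambda>x. x ^ (d - m) * lg x) w)
            - harm d)) (at 0)"
proof -
  interpret barnes_setup d \<theta> lg w
    by unfold_locales fact+
  \<comment> \<open>The factor \<open>fact m\<close> in the derivative of the Bernoullian function
    cancels, leaving the coefficients of the formal inverse.\<close>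
  have c: "poly ((pderiv ^^ d) (bernoullian d w m)) 0 / (fact m * fact (d - m)) = b m / fact (d - m)" for m
    by (subst higher_pderiv_bernoullian_0) (use d w_nonzero in \<open>auto simp: b_def\<close>)
  show ?thesis
    unfolding Let_def c atLeast0AtMost
      G_op_eq_fdiff[of d "\<lambda>x. x ^ (d - m) * lg x" for m]
    using DERIV_barnes_zeta by blast
qed

end
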